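(* Let $c>0$ be an absolute constant such that for all positive integers $n,m$, every $n\times n$ matrix $\mathbf{B}$ and every $\varepsilon>0$, if $\mathbf{v}_1,\ldots,\mathbf{v}_m$ are iid samples from $\operatorname{Unif}(\mathbb{S}^{n-1})$ then $$\mathbb{P}\Big[\big|n^{-1}\operatorname{tr}(\mathbf{B})-\tfrac1m\sum_{\ell=1}^m\mathbf{v}_\ell^*\mathbf{B}\mathbf{v}_\ell\big|>\varepsilon\Big]\le 2\exp\Big(-\frac{c\,n\,m\,\varepsilon^2}{\|\mathbf{B}\|_2^2}\Big).$$ Let $\mathbf{A}$ be an $n\times n$ Hermitian matrix with smallest and largest eigenvalues $\lambda_{\min}<\lambda_{\max}$. Fix constants $M>0$, $\rho>1$, $\varepsilon>0$ and $\delta\in(0,1)$. Let $s$ (odd) and $m$ be positive integers with $$s\ge\ln\Big(\frac{8M}{(\rho-1)\varepsilon}\Big)\frac{1}{\ln(\rho)},\qquad m\ge\frac{16M^2}{c\,(\rho-1)^2\,n\,\varepsilon^2}\ln\Big(\frac{2s}{\delta}\Big),$$ let $\mathbf{v}_1,\ldots,\mathbf{v}_m$ be iid samples from $\operatorname{Unif}(\mathbb{S}^{n-1})$, let $\Psi_\ell$ be the weighted cumulative empirical spectral measure of $\mathbf{A}$ and $\mathbf{v}_\ell$, and let $[\Psi_\ell]_s^{\mathrm{gq}}$ be its degree $s$ Gaussian quadrature rule. Then $$\mathbb{P}\Big[\exists f\in\mathsf{Anl}(M,\rho,\lambda_{\min},\lambda_{\max}):\ \Big|n^{-1}\operatorname{tr}(f(\mathbf{A}))-\frac1m\sum_{\ell=1}^m\int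 f\,d[\Psi_\ell]_s^{\mathrm{gq}}\Big|>\varepsilon\Big]\le\delta.$$
   Context: $\operatorname{Unif}(\mathbb{S}^{n-1})$ is the uniform distribution on unit vectors in $\mathbb{R}^n$; $^*$ is conjugate transpose; $\|\cdot\|_2$ is the spectral norm. For a Hermitian matrix $\mathbf{A}=\sum_{i=1}^n\lambda_i\mathbf{u}_i\mathbf{u}_i^*$ (orthonormal eigenvectors $\mathbf{u}_i$), $f(\mathbf{A})=\sum_i f(\lambda_i)\mathbf{u}_i\mathbf{u}_i^*$. For a unit vector $\mathbf{v}$, the weighted cumulative empirical spectral measure is the probability distribution function $\Psi(x)=\sum_{i=1}^n|\mathbf{v}^*\mathbf{u}_i|^2\,\mathbb{1}(\lambda_i\le x)$. Gaussian quadrature: for odd $s=2k-1$, $[\Psi]_{s}^{\mathrm{gq}}$ is the distribution function $\sum_{j=1}^k\omega_j\mathbb{1}(\theta_j\le x)$, where $\theta_1,\ldots,\theta_k$ are the zeros of the degree $k$ orthogonal polynomial with respect to $\Psi$, and the weights $\omega_j$ are such that $\int p\,d[\Psi]_s^{\mathrm{gq}}=\int p\,d\Psi$ for all polynomials $p$ of degree at most $k-1$ (equivalently, at most $2k-1$). If $k$ is at least the number of support points of $\Psi$, then $[\Psi]_s^{\mathrm{gq}}=\Psi$. For $\rho>1$ and $a<b$, $E_\rho(a,b)$ is the (open) region bounded by the ellipse centered at $\frac{a+b}{2}$ with semi-axis lengths $\frac{b-a}{2}\cdot\frac12(\rho+\rho^{-1})$ along the real direction and $\frac{b-a}{2}\cdot\frac12(\rho-\rho^{-1})$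 along the imaginary direction, i.e. $E_\rho(a,b)=\{\frac{b-a}{2}\cdot\frac12(u+u^{-1})+\frac{a+b}{2}: u=re^{i\theta},\ r\in[1,\rho),\ \theta\in[0,2\pi)\}$. $\mathsf{Anl}(M,\rho,a,b)$ is the set of analytic functions on $E_\rho(a,b)$ bounded in modulus by $M$ there. *)

theory Defs
  imports
    "HOL-Probability.Probability"
    "HOL-Complex_Analysis.Complex_Analysis"
    "HOL-Computational_Algebra.Polynomial"
    "Jordan_Normal_Form.Schur_Decomposition"
begin

unbundle no vec_syntax
no_notation inner (infix "\<bullet>" 70)

section \<open>The uniform distribution on the unit sphere\<close>

text \<open>Vectors of \<open>\<real>\<^sup>n\<close> are extensional functions on \<open>{..<n}\<close>, since the dimension is a term-level
  parameter.\<close>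

definition lborel_n :: "nat \<Rightarrow> (nat \<Rightarrow> real) measure" where
  "lborel_n n = PiM {..<n} (\<lambda>_. lborel)"

definition euclid_norm :: "nat \<Rightarrow> (nat \<Rightarrow> real) \<Rightarrow> real" where
  "euclid_norm n x = sqrt (\<Sum>i<n. (x i)\<^sup>2)"

text \<open>Normalised surface measure, as the law of the direction \<open>x / \<parallel>x\<parallel>\<close> of a uniformly distributed
  point \<open>x\<close> of the (punctured) unit ball. For \<open>n = 1\<close> it is the uniform distribution on \<open>{-1, 1}\<close>.\<close>

definition unif_sphere :: "nat \<Rightarrow> (nat \<Rightarrow> real) measure" where
  "unif_sphere n =
     distr (uniform_measure (lborel_n n)
              {x \<in> space (lborel_n n). 0 < euclid_norm n x \<and> euclid_norm n x \<le> 1})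
           (lborel_n n)
           (\<lambda>x. \<lambda>i\<in>{..<n}. x i / euclid_norm n x)"

definition cvec :: "nat \<Rightarrow> (nat \<Rightarrow> real) \<Rightarrow> complex Matrix.vec" where
  "cvec n x = Matrix.vec n (\<lambda>i. complex_of_real (x i))"

section \<open>Matrices\<close>

definition mat_trace :: "complex mat \<Rightarrow> complex" where
  "mat_trace B = (\<Sum>i<dim_row B. B $$ (i, i))"

text \<open>\<open>v\<^sup>* B v\<close>; recall that \<open>x \<bullet>c y\<close> is conjugate-linear in its second argument.\<close>

definition quad_form :: "complex mat \<Rightarrow> complex Matrix.vec \<Rightarrow> complex" where
  "quad_form B v = (B *\<^sub>v v) \<bullet>c v"

definition vec_norm2 :: "complex Matrix.vec \<Rightarrow> real" where
  "vec_norm2 v = sqrt (\<Sum>i<dim_vec v. (cmod (v $ i))\<^sup>2)"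

definition spectral_norm :: "complex mat \<Rightarrow> real" where
  "spectral_norm B =
     (SUP x \<in> {x \<in> carrier_vec (dim_col B). vec_norm2 x = 1}. vec_norm2 (B *\<^sub>v x))"

definition hermitian :: "complex mat \<Rightarrow> bool" where
  "hermitian A \<longleftrightarrow> mat_adjoint A = A"

definition min_eigenvalue :: "complex mat \<Rightarrow> real" where
  "min_eigenvalue A = Min {x. eigenvalue A (complex_of_real x)}"

definition max_eigenvalue :: "complex mat \<Rightarrow> real" where
  "max_eigenvalue A = Max {x. eigenvalue A (complex_of_real x)}"

text \<open>\<open>spectral_sum n g u\<close> is \<open>\<Sum>i<n. g i u\<^sub>i u\<^sub>i\<^sup>*\<close>.\<close>

definition spectral_sum :: "nat \<Rightarrow> (nat \<Rightarrow> complex) \<Rightarrow> (nat \<Rightarrow> complex Matrix.vec) \<Rightarrow> complex mat" where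
  "spectral_sum n g u = Matrix.mat n n (\<lambda>(a, b). \<Sum>i<n. g i * (u i $ a) * cnj (u i $ b))"

definition eigendecomposition ::
    "complex mat \<Rightarrow> (nat \<Rightarrow> real) \<Rightarrow> (nat \<Rightarrow> complex Matrix.vec) \<Rightarrow> bool" where
  "eigendecomposition A lam u \<longleftrightarrow>
     (let n = dim_row A in
       (\<forall>i<n. u i \<in> carrier_vec n) \<and>
       (\<forall>i<n. \<forall>j<n. u i \<bullet>c u j = (if i = j then 1 else 0)) \<and>
       A = spectral_sum n (\<lambda>i. complex_of_real (lam i)) u)"

text \<open>One eigendecomposition of a Hermitian matrix is chosen; neither of the two definitions based
  on it depends on the choice.\<close>

definition eigen_system :: "complex mat \<Rightarrow> (nat \<Rightarrow> real) \<times> (nat \<Rightarrow> complex Matrix.vec)" where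
  "eigen_system A = (SOME (lam, u). eigendecomposition A lam u)"

abbreviation eigval :: "complex mat \<Rightarrow> nat \<Rightarrow> real" where
  "eigval A \<equiv> fst (eigen_system A)"

abbreviation eigvec :: "complex mat \<Rightarrow> nat \<Rightarrow> complex Matrix.vec" where
  "eigvec A \<equiv> snd (eigen_system A)"

definition matrix_fun :: "(complex \<Rightarrow> complex) \<Rightarrow> complex mat \<Rightarrow> complex mat" where
  "matrix_fun f A =
     spectral_sum (dim_row A) (\<lambda>i. f (complex_of_real (eigval A i))) (eigvec A)"

definition weighted_cesm :: "complex mat \<Rightarrow> complex Matrix.vec \<Rightarrow> real \<Rightarrow> real" where
  "weighted_cesm A v x =
     (\<Sum>i<dim_row A. (cmod (eigvec A i \<bullet>c v))\<^sup>2 * indicator {eigval A i..} x)"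

section \<open>Gaussian quadrature of a distribution function\<close>

definition df_support :: "(real \<Rightarrow> real) \<Rightarrow> real set" where
  "df_support F = {x. \<forall>e>0. F (x - e) < F (x + e)}"

definition orthogonal_poly :: "(real \<Rightarrow> real) \<Rightarrow> nat \<Rightarrow> real poly \<Rightarrow> bool" where
  "orthogonal_poly F k p \<longleftrightarrow>
     p \<noteq> 0 \<and> degree p = k \<and>
     (\<forall>q. degree q < k \<longrightarrow> (LINT x|interval_measure F. poly p x * poly q x) = 0)"

text \<open>\<open>G\<close> is the distribution function with nodes at the zeros of the degree \<open>k\<close> orthogonal
  polynomial. The integral \<open>\<integral>q dG\<close> in the condition on the weights is written out as a finite sum
  because \<open>interval_measure\<close> is meaningful only once the weights are known to be nonnegative.\<close>

definition gauss_rule :: "(real \<Rightarrow> real) \<Rightarrow> nat \<Rightarrow> (real \<Rightarrow> real) \<Rightarrow> bool" where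
  "gauss_rule F k G \<longleftrightarrow>
     (\<exists>p w. orthogonal_poly F k p \<and>
        (\<forall>q. degree q \<le> k - 1 \<longrightarrow>
           (\<Sum>t | poly p t = 0. w t * poly q t) = (LINT x|interval_measure F. poly q x)) \<and>
        G = (\<lambda>x. \<Sum>t | poly p t = 0. w t * indicator {t..} x))"

definition gauss_quad :: "(real \<Rightarrow> real) \<Rightarrow> nat \<Rightarrow> real \<Rightarrow> real" where
  "gauss_quad F s =
     (let k = (s + 1) div 2 in
       if finite (df_support F) \<and> card (df_support F) \<le> k then F
       else (SOME G. gauss_rule F k G))"

section \<open>Analytic functions on a Bernstein ellipse\<close>

definition bernstein_ellipse :: "real \<Rightarrow> real \<Rightarrow> real \<Rightarrow> complex set" where
  "bernstein_ellipse \<rho> a b =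
     (\<lambda>u. complex_of_real ((b - a) / 2) * (1 / 2) * (u + inverse u)
            + complex_of_real ((a + b) / 2)) ` {u. 1 \<le> norm u \<and> norm u < \<rho>}"

definition Anl :: "real \<Rightarrow> real \<Rightarrow> real \<Rightarrow> real \<Rightarrow> (complex \<Rightarrow> complex) set" where
  "Anl M \<rho> a b =
     {f. f analytic_on bernstein_ellipse \<rho> a b \<and> (\<forall>z\<in>bernstein_ellipse \<rho> a b. norm (f z) \<le> M)}"

text \<open>\<open>\<integral>f dF\<close> for a function \<open>f\<close> with domain \<open>D\<close>. The values of \<open>f\<close> outside \<open>D\<close> are arbitrary and need
  not even be measurable, hence the restriction to \<open>D\<close>.\<close>

definition df_integral :: "complex set \<Rightarrow> (real \<Rightarrow> real) \<Rightarrow> (complex \<Rightarrow> complex) \<Rightarrow> complex" where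
  "df_integral D F f =
     (LINT x:{x. complex_of_real x \<in> D}|interval_measure F. f (complex_of_real x))"

end

theory Submission
  imports Defs
begin

no_notation fps_nth (infixl "$" 75)

text \<open>
  Fix a realisation of the samples and consider
  \<open>\<Lambda> f = n\<^sup>-\<^sup>1 tr f(A) - m\<^sup>-\<^sup>1 \<Sum>l. \<integral>f d[\<Psi>\<^sub>l]\<close>, where \<open>[\<Psi>\<^sub>l]\<close> is the Gauss rule. Both terms are averages of
  point evaluations in the spectral interval \<open>[\<lambda>\<^sub>m\<^sub>i\<^sub>n, \<lambda>\<^sub>m\<^sub>a\<^sub>x]\<close>, so \<open>\<Lambda>\<close> is linear, vanishes on constants, and
  satisfies \<open>|\<Lambda> f| \<le> 2 sup |f|\<close>. Let \<open>T\<^sub>j\<close> be the Chebyshev polynomials transported to the spectral interval.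
  A function \<open>f\<close> that is analytic and bounded by \<open>M\<close> on the Bernstein ellipse agrees on the interval with a
  sum \<open>\<Sum>j\<le>s. \<alpha>\<^sub>j T\<^sub>j\<close>, where \<open>|\<alpha>\<^sub>j| \<le> 2M/\<rho>\<^sup>j\<close>, up to an error \<open>2M/(\<rho>\<^sup>s(\<rho>-1))\<close>; strictly speaking, this holds with
  every \<open>r < \<rho>\<close> in place of \<open>\<rho>\<close>, and \<open>r\<close> tends to \<open>\<rho>\<close> in the final estimate for \<open>\<Lambda> f\<close>. Hence
  \<open>|\<Lambda> f| \<le> \<Sum>1\<le>j\<le>s. 2M\<rho>\<^sup>-\<^sup>j |\<Lambda> T\<^sub>j| + 4M/(\<rho>\<^sup>s(\<rho>-1))\<close> (\<open>Anl_functional_bound\<close>).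

  The Gauss rule is exact up to degree \<open>s\<close> (\<open>gauss_quad_step_df\<close>), so for \<open>j \<le> s\<close> the number \<open>\<Lambda> T\<^sub>j\<close> is the error of
  the stochastic trace estimator \<open>m\<^sup>-\<^sup>1 \<Sum>l. v\<^sub>l\<^sup>* T\<^sub>j(A) v\<^sub>l\<close> for the one matrix \<open>T\<^sub>j(A)\<close>, whose spectral norm is \<open>1\<close>. The
  assumed concentration inequality bounds these \<open>s\<close> errors, and since none of them involves \<open>f\<close>, a
  union bound over \<open>1 \<le> j \<le> s\<close> handles all \<open>f\<close> at once. With the threshold \<open>\<tau> = \<epsilon>(\<rho>-1)/(4M)\<close> the first part of
  the estimate sums to at most \<open>\<epsilon>/2\<close>; the hypothesis on \<open>s\<close> makes the second part at most \<open>\<epsilon>/2\<close>, and the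
  hypothesis on \<open>m\<close> makes each of the \<open>s\<close> exceptional probabilities at most \<open>\<delta>/s\<close>. This argument needs
  \<open>\<parallel>v\<^sub>l\<parallel> = 1\<close>, which holds almost surely.

  Three classical facts carry the argument. Gauss quadrature: an orthogonal polynomial that had a
  double root, a root outside the interval or too few real roots would have a constant sign against
  some polynomial of lower degree (\<open>orthogonal_poly_roots\<close>). Chebyshev approximation: the substitution
  \<open>z = (u + 1/u)/2\<close> turns the Cauchy formula on an ellipse into an integral over a circle whose kernel is
  the generating function of the Chebyshev polynomials (\<open>joukowski_Cauchy_formula\<close>,
  \<open>chebyshev_approximation\<close>). The spectral theorem: orthonormal eigenvectors of a Hermitian matrix can be
  extended one at a time, the next one being found by deflation and a trace argument
  (\<open>hermitian_orthogonal_eigenvector\<close>).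
\<close>

section \<open>Distribution functions with finitely many jumps\<close>

text \<open>The common form of the spectral measures and of their Gauss rules. Negative weights are allowed,
  because the weights of a rule are known to be nonnegative only after exactness has been shown.\<close>

definition step_df :: "real set \<Rightarrow> (real \<Rightarrow> real) \<Rightarrow> real \<Rightarrow> real" where
  "step_df S w = (\<lambda>x. \<Sum>t\<in>S. w t * indicator {t..} x)"

text \<open>Both sides are finite Borel measures on the line, so it suffices to compare their distribution
  functions.\<close>

lemma interval_measure_step_df:
  assumes "finite S" and w: "\<And>t. t \<in> S \<Longrightarrow> 0 \<le> w t"
  shows "interval_measure (step_df S w) = distr (point_measure S (\<lambda>t. ennreal (w t))) borel (\<lambda>t. t)"
    (is "_ = ?N")
proof (rule cdf_unique')
  let ?P = "point_measure S (\<lambda>t. ennreal (w t))"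
  have meas: "(\<lambda>t. t) \<in> ?P \<rightarrow>\<^sub>M borel"
    by (simp add: measurable_def space_point_measure sets_point_measure)
  have emea: "emeasure ?N X = ennreal (\<Sum>t\<in>S \<inter> X. w t)" if "X \<in> sets borel" for X
  proof -
    have "emeasure ?N X = emeasure ?P (S \<inter> X)"
      using that meas by (subst emeasure_distr) (auto simp: space_point_measure Int_commute)
    also have "\<dots> = (\<Sum>t\<in>S \<inter> X. ennreal (w t))"
      using assms by (intro emeasure_point_measure_finite) auto
    also have "\<dots> = ennreal (\<Sum>t\<in>S \<inter> X. w t)"
      using w by (intro sum_ennreal) auto
    finally show ?thesis .
  qed
  have "finite_measure ?N"
    by (rule finite_measureI) (simp add: emea)
  then show fin: "finite_borel_measure ?N"
    by (simp add: finite_borel_measure_def finite_borel_measure_axioms_def)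
  have cdfN: "cdf ?N x = step_df S w x" for x
  proof -
    have "cdf ?N x = (\<Sum>t\<in>S \<inter> {..x}. w t)"
      unfolding cdf_def measure_def using sum_nonneg[of "S \<inter> {..x}" w] w by (simp add: emea)
    also have "\<dots> = step_df S w x"
      unfolding step_df_def using \<open>finite S\<close>
      by (intro sum.mono_neutral_cong_left) (auto simp: indicator_def)
    finally show ?thesis .
  qed
  then have eq: "step_df S w = cdf ?N" by auto
  interpret finite_borel_measure ?N by fact
  show "finite_borel_measure (interval_measure (step_df S w))" unfolding eq
    by (rule finite_borel_measure_interval_measure[OF cdf_nondecreasing cdf_is_right_cont
      cdf_lim_at_bot cdf_lim_at_top measure_nonneg])
  show "cdf (interval_measure (step_df S w)) = cdf ?N" unfolding eq
    by (rule cdf_interval_measure[OF cdf_nondecreasing cdf_is_right_cont cdf_lim_at_bot])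
qed

lemma integral_step_df:
  fixes g :: "real \<Rightarrow> 'b::{banach, second_countable_topology}"
  assumes "finite S" "\<And>t. t \<in> S \<Longrightarrow> 0 \<le> w t" "g \<in> borel_measurable borel"
  shows "(LINT x|interval_measure (step_df S w). g x) = (\<Sum>t\<in>S. w t *\<^sub>R g t)"
proof -
  have meas: "(\<lambda>t. t) \<in> point_measure S (\<lambda>t. ennreal (w t)) \<rightarrow>\<^sub>M borel"
    by (simp add: measurable_def space_point_measure sets_point_measure)
  show ?thesis
    using assms(1,2)
    by (simp add: interval_measure_step_df integral_distr[OF meas assms(3)]
        lebesgue_integral_point_measure_finite)
qed

text \<open>Openness of \<open>D\<close> and continuity of \<open>f\<close> serve only to make the integrand, cut off outside \<open>D\<close>, Borel
  measurable.\<close>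

lemma df_integral_step_df:
  assumes "finite S" "\<And>t. t \<in> S \<Longrightarrow> 0 \<le> w t" "\<And>t. t \<in> S \<Longrightarrow> complex_of_real t \<in> D"
    and "open D" "continuous_on D f"
  shows "df_integral D (step_df S w) f = (\<Sum>t\<in>S. complex_of_real (w t) * f (complex_of_real t))"
proof -
  let ?R = "{x. complex_of_real x \<in> D}"
  have "open ?R"
    using open_vimage[OF \<open>open D\<close>, of complex_of_real] continuous_on_of_real_id
    by (simp add: vimage_def)
  moreover have "continuous_on ?R (\<lambda>x. f (complex_of_real x))"
    by (rule continuous_on_compose2[OF \<open>continuous_on D f\<close>]) (auto intro: continuous_intros)
  ultimately have "(\<lambda>x. indicator ?R x *\<^sub>R f (complex_of_real x)) \<in> borel_measurable borel"
    by (intro borel_measurable_continuous_on_indicator) auto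
  then have "df_integral D (step_df S w) f
    = (\<Sum>t\<in>S. w t *\<^sub>R (indicator ?R t *\<^sub>R f (complex_of_real t)))"
    unfolding df_integral_def set_lebesgue_integral_def using assms(1,2)
    by (rule integral_step_df[rotated 2])
  also have "\<dots> = (\<Sum>t\<in>S. complex_of_real (w t) * f (complex_of_real t))"
    using assms(3) by (intro sum.cong) (auto simp: scaleR_conv_of_real)
  finally show ?thesis .
qed

lemma integral_poly_step_df:
  assumes "finite S" "\<And>t. t \<in> S \<Longrightarrow> 0 \<le> w t"
  shows "(LINT x|interval_measure (step_df S w). poly p x) = (\<Sum>t\<in>S. w t * poly p t)"
  using integral_step_df[of S w "poly p", OF assms]
  by (simp add: borel_measurable_continuous_onI continuous_on_poly)

text \<open>Turns the hypothesis of the nontrivial case of the Gauss rule, more than \<open>k\<close> points in the support,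
  into more than \<open>k\<close> atoms.\<close>

lemma df_support_step_df_subset:
  assumes "finite S"
  shows "df_support (step_df S w) \<subseteq> S"
proof (rule subsetI, rule ccontr)
  fix x assume x: "x \<in> df_support (step_df S w)" "x \<notin> S"
  have "open (- S)" using assms by (simp add: finite_imp_closed open_Compl)
  with x(2) obtain e where e: "e > 0" "ball x e \<subseteq> - S"
    by (meson ComplI openE)
  have "step_df S w (x - e/2) = step_df S w (x + e/2)"
    unfolding step_df_def
  proof (intro sum.cong refl)
    fix t assume "t \<in> S"
    then have "t \<notin> ball x e" using e by auto
    then have "\<bar>x - t\<bar> \<ge> e" by (auto simp: dist_real_def)
    then have "t \<le> x - e/2 \<longleftrightarrow> t \<le> x + e/2" using e by linarith
    then show "w t * indicator {t..} (x - e / 2) = w t * indicator {t..} (x + e / 2)"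
      by (simp add: indicator_def)
  qed
  moreover have "e / 2 > 0" using e by simp
  ultimately show False using x(1) unfolding df_support_def by fastforce
qed

section \<open>Orthogonal polynomials of a discrete measure\<close>

text \<open>A polynomial with fewer roots than there are atoms cannot vanish at all of them.\<close>

lemma weighted_sum_poly_pos:
  fixes w :: "real \<Rightarrow> real"
  assumes "finite S" and w: "\<And>t. t \<in> S \<Longrightarrow> 0 < w t"
    and nonneg: "\<And>t. t \<in> S \<Longrightarrow> 0 \<le> poly r t"
    and few: "finite {t. poly r t = 0}" "card {t. poly r t = 0} < card S"
  shows "0 < (\<Sum>t\<in>S. w t * poly r t)"
proof -
  have "\<not> S \<subseteq> {t. poly r t = 0}"
    using card_mono[OF few(1), of S] few(2) by linarith
  then obtain t where t: "t \<in> S" "poly r t \<noteq> 0" by auto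
  then have "0 < poly r t" using nonneg[of t] by simp
  show ?thesis
  proof (rule sum_pos2[OF \<open>finite S\<close> t(1)])
    show "0 < w t * poly r t" using w[OF t(1)] \<open>0 < poly r t\<close> by (rule mult_pos_pos)
    show "0 \<le> w i * poly r i" if "i \<in> S" for i
      using less_imp_le[OF w[OF that]] nonneg[OF that] by (rule mult_nonneg_nonneg)
  qed
qed

text \<open>Gram-Schmidt, arranged as an induction on \<open>k\<close>: the projections of all \<open>g\<close> onto degree less than \<open>k + 1\<close>
  are obtained from those onto degree less than \<open>k\<close> by adding a multiple of the monic orthogonal
  polynomial \<open>e\<close> of degree \<open>k\<close>, which is itself the residual of a projection. The condition \<open>k \<le> card S\<close>
  ensures \<open>\<langle>e, e\<rangle> \<noteq> 0\<close>. Low degree is expressed by vanishing coefficients, so that for \<open>k = 0\<close> only the zero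
  polynomial is left.\<close>

lemma projection_onto_low_degree_exists:
  fixes w :: "real \<Rightarrow> real"
  assumes "finite S" and w: "\<And>t. t \<in> S \<Longrightarrow> 0 < w t" and "k \<le> card S"
  shows "\<exists>h. (\<forall>i\<ge>k. coeff h i = 0) \<and>
    (\<forall>q. (\<forall>i\<ge>k. coeff q i = 0) \<longrightarrow> (\<Sum>t\<in>S. w t * (poly (g - h) t * poly q t)) = 0)"
  using \<open>k \<le> card S\<close>
proof (induction k arbitrary: g)
  case 0
  show ?case
  proof (intro exI[of _ 0] conjI allI impI)
    fix q :: "real poly" assume "\<forall>i\<ge>0. coeff q i = 0"
    then have "q = 0" by (simp add: poly_eq_iff)
    then show "(\<Sum>t\<in>S. w t * (poly (g - 0) t * poly q t)) = 0" by simp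
  qed simp
next
  case (Suc k)
  define ip where "ip = (\<lambda>p q :: real poly. \<Sum>t\<in>S. w t * (poly p t * poly q t))"
  have ip_diff: "ip (p - p') q = ip p q - ip p' q" for p p' q
    by (simp add: ip_def algebra_simps sum_subtractf)
  have ip_add_right: "ip p (q + q') = ip p q + ip p q'" for p q q'
    by (simp add: ip_def algebra_simps sum.distrib)
  have ip_smult: "ip (Polynomial.smult c p) q = c * ip p q" "ip p (Polynomial.smult c q) = c * ip p q" for c p q
    by (simp_all add: ip_def sum_distrib_left mult_ac)
  have ip_comm: "ip p q = ip q p" for p q
    by (simp add: ip_def mult.commute)
  obtain h where h: "\<And>i. i \<ge> k \<Longrightarrow> coeff h i = 0"
      "\<And>q. \<forall>i\<ge>k. coeff q i = 0 \<Longrightarrow> ip (g - h) q = 0"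
    using Suc.IH[of g] Suc.prems unfolding ip_def by auto
  obtain h' where h': "\<And>i. i \<ge> k \<Longrightarrow> coeff h' i = 0"
      "\<And>q. \<forall>i\<ge>k. coeff q i = 0 \<Longrightarrow> ip (monom 1 k - h') q = 0"
    using Suc.IH[of "monom 1 k"] Suc.prems unfolding ip_def by auto
  define e where "e = monom 1 k - h'"
  have e_coeff: "coeff e k = 1" "\<And>i. i > k \<Longrightarrow> coeff e i = 0"
    using h'(1) by (auto simp: e_def)
  then have "e \<noteq> 0" by auto
  have "degree e \<le> k" using e_coeff(2) by (intro degree_le) auto
  have "ip e e > 0"
  proof -
    have roots: "{t. poly (e * e) t = 0} = {t. poly e t = 0}" by auto
    have "card {t. poly e t = 0} \<le> k"
      using card_poly_roots_bound[OF \<open>e \<noteq> 0\<close>] \<open>degree e \<le> k\<close> by simp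
    then have "0 < (\<Sum>t\<in>S. w t * poly (e * e) t)"
      using Suc.prems \<open>finite S\<close> w \<open>e \<noteq> 0\<close>
      by (intro weighted_sum_poly_pos) (auto simp: roots poly_roots_finite)
    then show ?thesis by (simp add: ip_def)
  qed
  have e_orth: "ip e q = 0" if "\<forall>i\<ge>k. coeff q i = 0" for q
    using h'(2)[OF that] by (simp add: e_def)
  define h1 where "h1 = h + Polynomial.smult (ip g e / ip e e) e"
  have split_h1: "ip (g - h1) q = ip (g - h) q - ip g e / ip e e * ip e q" for q
  proof -
    have "g - h1 = (g - h) - Polynomial.smult (ip g e / ip e e) e" by (simp add: h1_def)
    then show ?thesis by (simp only: ip_diff ip_smult)
  qed
  have "ip h e = 0" using e_orth[of h] h(1) by (simp add: ip_comm)
  then have "ip (g - h1) e = 0"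
    using \<open>ip e e > 0\<close> unfolding split_h1 by (simp add: ip_diff)
  have low: "ip (g - h1) q = 0" if "\<forall>i\<ge>k. coeff q i = 0" for q
    unfolding split_h1 using h(2)[OF that] e_orth[OF that] by simp
  show ?case
  proof (intro exI[of _ h1] conjI allI impI)
    fix i assume "Suc k \<le> i"
    then show "coeff h1 i = 0" using h(1) e_coeff(2) by (simp add: h1_def)
  next
    fix q :: "real poly" assume q: "\<forall>i\<ge>Suc k. coeff q i = 0"
    have "coeff (q - Polynomial.smult (coeff q k) e) i = 0" if "i \<ge> k" for i
      using q e_coeff that by (cases "i = k") auto
    then have "ip (g - h1) (q - Polynomial.smult (coeff q k) e) = 0" by (intro low allI impI)
    moreover have "ip (g - h1) q
      = ip (g - h1) (q - Polynomial.smult (coeff q k) e) + ip (g - h1) (Polynomial.smult (coeff q k) e)"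
      unfolding ip_add_right[symmetric] by (simp only: diff_add_cancel)
    ultimately have "ip (g - h1) q = 0"
      using \<open>ip (g - h1) e = 0\<close> by (simp only: ip_smult)
    then show "(\<Sum>t\<in>S. w t * (poly (g - h1) t * poly q t)) = 0" by (simp add: ip_def)
  qed
qed

lemma discrete_orthogonal_poly_exists:
  fixes w :: "real \<Rightarrow> real"
  assumes "finite S" and "\<And>t. t \<in> S \<Longrightarrow> 0 < w t" and "k \<le> card S"
  obtains p where "p \<noteq> 0" "degree p = k"
    "\<And>q. degree q < k \<Longrightarrow> (\<Sum>t\<in>S. w t * (poly p t * poly q t)) = 0"
proof -
  obtain h where h: "\<And>i. i \<ge> k \<Longrightarrow> coeff h i = 0"
      "\<And>q. \<forall>i\<ge>k. coeff q i = 0 \<Longrightarrow> (\<Sum>t\<in>S. w t * (poly (monom 1 k - h) t * poly q t)) = 0"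
    using projection_onto_low_degree_exists[of S w k "monom 1 k", OF assms] by auto
  define p where "p = monom 1 k - h"
  have "coeff p k = 1" "\<And>i. i > k \<Longrightarrow> coeff p i = 0" using h(1) by (auto simp: p_def)
  then have "p \<noteq> 0" "degree p \<le> k" "k \<le> degree p"
    by (force, simp add: degree_le, simp add: le_degree)
  then have "degree p = k" by simp
  moreover note \<open>p \<noteq> 0\<close>
  moreover have "(\<Sum>t\<in>S. w t * (poly p t * poly q t)) = 0" if "degree q < k" for q
    using that unfolding p_def by (intro h(2)) (auto intro: coeff_eq_0)
  ultimately show thesis using that by blast
qed

lemma prod_root_factors_dvd:
  fixes p :: "real poly"
  assumes "finite Z" "\<And>t. t \<in> Z \<Longrightarrow> poly p t = 0"
  shows "(\<Prod>t\<in>Z. [:- t, 1:]) dvd p"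
  using assms
proof (induction Z rule: finite_induct)
  case empty
  show ?case by simp
next
  case (insert a Z)
  then have "(\<Prod>t\<in>Z. [:- t, 1:]) dvd p" by simp
  then obtain g where g: "p = (\<Prod>t\<in>Z. [:- t, 1:]) * g" by (rule dvdE)
  have "poly p a = 0" using insert.prems by simp
  moreover have "poly (\<Prod>t\<in>Z. [:- t, 1:]) a \<noteq> 0"
    using insert.hyps by (auto simp: poly_prod)
  ultimately have "poly g a = 0" using g by simp
  then have "[:- a, 1:] dvd g" by (simp only: poly_eq_0_iff_dvd)
  then have "(\<Prod>t\<in>Z. [:- t, 1:]) * [:- a, 1:] dvd p"
    unfolding g by (rule mult_dvd_mono[OF dvd_refl])
  then show ?case using insert.hyps by (simp only: prod.insert not_False_eq_True mult.commute)
qed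

lemma poly_no_root_const_sign:
  fixes g :: "real poly"
  assumes "\<And>x. poly g x \<noteq> 0"
  shows "(\<forall>x. 0 < poly g x) \<or> (\<forall>x. poly g x < 0)"
proof (rule ccontr)
  assume "\<not> ?thesis"
  then obtain x y where xy: "poly g x < 0" "0 < poly g y"
    using assms by (meson linorder_neqE_linordered_idom)
  then have "x \<noteq> y" by auto
  then show False
    using poly_IVT_pos[of x y g] poly_IVT_neg[of y x g] xy assms by (cases "x < y") auto
qed

text \<open>Otherwise \<open>p q\<close> is nonnegative on \<open>S\<close> and has at most \<open>k\<close> roots, so that \<open>\<Sum> w p q > 0\<close>, against
  orthogonality. All information on the roots of \<open>p\<close> is extracted from this by suitable choices of \<open>q\<close>.\<close>

lemma orthogonal_poly_sign_change:
  fixes w :: "real \<Rightarrow> real"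
  assumes "finite S" and w: "\<And>t. t \<in> S \<Longrightarrow> 0 < w t" and "k < card S"
    and p: "p \<noteq> 0" "degree p = k"
    and orth: "\<And>q. degree q < k \<Longrightarrow> (\<Sum>t\<in>S. w t * (poly p t * poly q t)) = 0"
    and q: "degree q < k" "\<And>t. poly q t = 0 \<Longrightarrow> poly p t = 0"
  shows "\<exists>t\<in>S. poly p t * poly q t < 0"
proof (rule ccontr)
  assume "\<not> ?thesis"
  then have nonneg: "\<And>t. t \<in> S \<Longrightarrow> 0 \<le> poly (p * q) t" by force
  have "{t. poly (p * q) t = 0} = {t. poly p t = 0}" using q(2) by auto
  moreover have "card {t. poly p t = 0} \<le> k"
    using card_poly_roots_bound[OF p(1)] p(2) by simp
  ultimately have "0 < (\<Sum>t\<in>S. w t * poly (p * q) t)"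
    using assms(1-3) nonneg p(1)
    by (intro weighted_sum_poly_pos) (auto simp: poly_roots_finite)
  with orth[OF q(1)] show False by simp
qed

text \<open>Three choices of \<open>q\<close> in \<open>orthogonal_poly_sign_change\<close>: for a root \<open>r\<close> outside \<open>{a..b}\<close> take \<open>\<plusminus>p/(x - r)\<close>, for a
  double root \<open>r\<close> take \<open>p/(x - r)\<^sup>2\<close>, and if there are fewer than \<open>k\<close> real roots take \<open>\<plusminus>\<close> the product of the
  linear factors of the distinct real roots. In the last case the cofactor has no real root and hence
  a constant sign.\<close>

lemma orthogonal_poly_roots:
  fixes w :: "real \<Rightarrow> real"
  assumes "finite S" and w: "\<And>t. t \<in> S \<Longrightarrow> 0 < w t" and "k < card S" and "S \<subseteq> {a..b}"
    and p: "p \<noteq> 0" "degree p = k"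
    and orth: "\<And>q. degree q < k \<Longrightarrow> (\<Sum>t\<in>S. w t * (poly p t * poly q t)) = 0"
  shows "{t. poly p t = 0} \<subseteq> {a..b}" and "card {t. poly p t = 0} = k"
proof -
  let ?Z = "{t. poly p t = 0}"
  have sign_change: "\<exists>t\<in>S. poly p t * poly q t < 0"
    if "degree q < k" "\<And>t. poly q t = 0 \<Longrightarrow> poly p t = 0" for q
    by (rule orthogonal_poly_sign_change[of S w k p q]) (fact assms that)+
  have "finite ?Z" using p(1) by (simp add: poly_roots_finite)
  have div: "\<exists>g. p = [:- r, 1:] * g \<and> degree g < k" if "poly p r = 0" for r
  proof -
    have "[:- r, 1:] dvd p" using that by (simp only: poly_eq_0_iff_dvd)
    then obtain g where g: "p = [:- r, 1:] * g" by (rule dvdE)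
    with p have "g \<noteq> 0" by auto
    then have "degree p = Suc (degree g)" unfolding g by (subst degree_mult_eq) auto
    then show ?thesis using g p by auto
  qed
  show "?Z \<subseteq> {a..b}"
  proof (rule subsetI, rule ccontr)
    fix r assume r: "r \<in> ?Z" "r \<notin> {a..b}"
    then obtain g where g: "p = [:- r, 1:] * g" "degree g < k" using div by auto
    have eq: "poly p t * poly g t = (t - r) * (poly g t)\<^sup>2" for t
      unfolding g by (simp add: power2_eq_square algebra_simps)
    show False
    proof (cases "r < a")
      case True
      obtain t where "t \<in> S" "poly p t * poly g t < 0"
        using sign_change[of g] g by auto
      then have "t \<in> S" "(t - r) * (poly g t)\<^sup>2 < 0" using eq[of t] by auto
      moreover have "t - r \<ge> 0" using \<open>t \<in> S\<close> True \<open>S \<subseteq> {a..b}\<close> by force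
      then have "0 \<le> (t - r) * (poly g t)\<^sup>2" by (rule mult_nonneg_nonneg) simp
      ultimately show False by linarith
    next
      case False
      then have "r > b" using r by auto
      obtain t where "t \<in> S" "poly p t * poly (- g) t < 0"
        using sign_change[of "- g"] g by auto
      then have "t \<in> S" "0 < (t - r) * (poly g t)\<^sup>2" using eq[of t] by auto
      moreover have "t - r \<le> 0" using \<open>t \<in> S\<close> \<open>r > b\<close> \<open>S \<subseteq> {a..b}\<close> by force
      then have "(t - r) * (poly g t)\<^sup>2 \<le> 0" by (rule mult_nonpos_nonneg) simp
      ultimately show False by linarith
    qed
  qed
  show "card ?Z = k"
  proof (rule ccontr)
    assume "card ?Z \<noteq> k"
    then have "card ?Z < k" using card_poly_roots_bound[OF p(1)] p(2) by simp
    obtain g where g: "p = (\<Prod>t\<in>?Z. [:- t, 1:]) * g"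
      using prod_root_factors_dvd[OF \<open>finite ?Z\<close>, of p] by (auto elim: dvdE)
    define Q where "Q = (\<Prod>t\<in>?Z. [:- t, 1:])"
    have pQ: "p = Q * g" using g by (simp add: Q_def)
    have Q_root: "poly Q t = 0 \<longleftrightarrow> poly p t = 0" for t
      unfolding Q_def using \<open>finite ?Z\<close> by (auto simp: poly_prod)
    have "degree Q = card ?Z" unfolding Q_def by (subst degree_prod_eq_sum_degree) auto
    have "poly g r \<noteq> 0" for r
    proof
      assume gr: "poly g r = 0"
      then have "poly p r = 0" "poly Q r = 0" using pQ Q_root by auto
      then have "[:- r, 1:] dvd g" "[:- r, 1:] dvd Q" using gr by (simp_all only: poly_eq_0_iff_dvd)
      then obtain g1 Q1 where g1: "g = [:- r, 1:] * g1" and Q1: "Q = [:- r, 1:] * Q1"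
        by (elim dvdE)
      define q where "q = g1 * Q1"
      have pq: "p = [:- r, 1:] * ([:- r, 1:] * q)" by (simp only: pQ g1 Q1 q_def mult_ac)
      with p have "q \<noteq> 0" by auto
      have deg_linear: "degree ([:- r, 1:] * h) = Suc (degree h)" if "h \<noteq> 0" for h :: "real poly"
        using that by (subst degree_mult_eq) auto
      have "[:- r, 1:] * q \<noteq> 0" using \<open>q \<noteq> 0\<close> by (simp only: mult_eq_0_iff) simp
      then have "degree p = Suc (Suc (degree q))"
        unfolding pq using \<open>q \<noteq> 0\<close> by (simp only: deg_linear simp_thms)
      then have "degree q < k" using p by simp
      then obtain t where "t \<in> S" "poly p t * poly q t < 0"
        using sign_change[of q] pq by auto
      moreover have "poly p t * poly q t = ((t - r) * poly q t)\<^sup>2"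
        unfolding pq by (simp add: power2_eq_square algebra_simps)
      ultimately show False by simp
    qed
    then consider "\<forall>x. 0 < poly g x" | "\<forall>x. poly g x < 0"
      using poly_no_root_const_sign[of g] by blast
    then show False
    proof cases
      case 1
      obtain t where "poly p t * poly Q t < 0"
        using sign_change[of Q] \<open>degree Q = card ?Z\<close> \<open>card ?Z < k\<close> Q_root by auto
      then have "(poly Q t)\<^sup>2 * poly g t < 0"
        unfolding pQ by (simp add: power2_eq_square algebra_simps)
      moreover have "0 \<le> (poly Q t)\<^sup>2 * poly g t"
        using 1 by (intro mult_nonneg_nonneg) (auto simp: less_imp_le)
      ultimately show False by linarith
    next
      case 2
      obtain t where "poly p t * poly (- Q) t < 0"
        using sign_change[of "- Q"] \<open>degree Q = card ?Z\<close> \<open>card ?Z < k\<close> Q_root by auto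
      then have "(poly Q t)\<^sup>2 * poly g t > 0"
        unfolding pQ by (simp add: power2_eq_square algebra_simps)
      moreover have "(poly Q t)\<^sup>2 * poly g t \<le> 0"
        using 2 by (intro mult_nonneg_nonpos) (auto simp: less_imp_le)
      ultimately show False by linarith
    qed
  qed
qed

text \<open>The weights are the values of \<open>L\<close> on the Lagrange basis polynomials of \<open>Z\<close>.\<close>

lemma interpolatory_weights_exist:
  fixes L :: "real poly \<Rightarrow> real"
  assumes add: "\<And>p q. L (p + q) = L p + L q" and smult: "\<And>c p. L (Polynomial.smult c p) = c * L p"
    and Z: "finite Z" "Z \<noteq> {}"
  obtains w where "\<And>q. degree q < card Z \<Longrightarrow> (\<Sum>t\<in>Z. w t * poly q t) = L q"
proof
  \<comment> \<open>Lagrange basis polynomials: \<open>l t\<close> is \<open>1\<close> at \<open>t\<close> and \<open>0\<close> at the other points of \<open>Z\<close>.\<close>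
  define l where "l = (\<lambda>t::real. \<Prod>z\<in>Z - {t}. Polynomial.smult (1 / (t - z)) [:- z, 1:])"
  have l_eval: "poly (l t) z = (if z = t then 1 else 0)" if "t \<in> Z" "z \<in> Z" for t z
  proof (cases "z = t")
    case True
    then show ?thesis by (auto simp: l_def poly_prod diff_divide_distrib[symmetric] intro!: prod.neutral)
  next
    case False
    then show ?thesis using that Z by (auto simp: l_def poly_prod intro!: prod_zero bexI[of _ z])
  qed
  have l_deg: "degree (l t) < card Z" if "t \<in> Z" for t
  proof -
    have "degree (l t) \<le> (\<Sum>z\<in>Z - {t}. degree (Polynomial.smult (1 / (t - z)) [:- z, 1:]))"
      using degree_prod_sum_le[of "Z - {t}" "\<lambda>z. Polynomial.smult (1 / (t - z)) [:- z, 1:]"] Z(1)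
      by (simp only: l_def o_def finite_Diff simp_thms)
    also have "\<dots> \<le> (\<Sum>z\<in>Z - {t}. 1)" by (intro sum_mono) simp
    also have "\<dots> < card Z" using that Z by (simp add: card_gt_0_iff)
    finally show ?thesis .
  qed
  have L0: "L 0 = 0" using smult[of 0 0] by simp
  have L_sum: "L (\<Sum>t\<in>T. f t) = (\<Sum>t\<in>T. L (f t))" if "finite T" for f T
    using that by (induction rule: finite_induct) (auto simp: add L0)
  fix q :: "real poly" assume q: "degree q < card Z"
  have "q = (\<Sum>t\<in>Z. Polynomial.smult (poly q t) (l t))"
  proof (rule poly_eqI_degree[where A = Z])
    fix x assume x: "x \<in> Z"
    have "poly (\<Sum>t\<in>Z. Polynomial.smult (poly q t) (l t)) x = (\<Sum>t\<in>Z. if x = t then poly q t else 0)"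
      using x l_eval by (auto simp: poly_sum intro!: sum.cong)
    then show "poly q x = poly (\<Sum>t\<in>Z. Polynomial.smult (poly q t) (l t)) x" using x Z by simp
  next
    have "degree (\<Sum>t\<in>Z. Polynomial.smult (poly q t) (l t)) \<le> card Z - 1"
      using l_deg by (intro degree_sum_le) (use Z in \<open>auto intro: order.trans[OF degree_smult_le]\<close>, fastforce)
    then show "degree (\<Sum>t\<in>Z. Polynomial.smult (poly q t) (l t)) < card Z"
      using Z by (metis One_nat_def Suc_pred card_gt_0_iff less_Suc_eq_le)
  qed (use q in auto)
  then have "L q = L (\<Sum>t\<in>Z. Polynomial.smult (poly q t) (l t))" by simp
  also have "\<dots> = (\<Sum>t\<in>Z. L (l t) * poly q t)"
    using Z by (simp add: L_sum smult mult.commute)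
  finally show "(\<Sum>t\<in>Z. L (l t) * poly q t) = L q" by simp
qed

section \<open>Gauss quadrature\<close>

lemma gauss_rule_exists:
  assumes "finite S" and w: "\<And>t. t \<in> S \<Longrightarrow> 0 < w t" and "S \<subseteq> {a..b}"
    and k: "0 < k" "k < card S"
  obtains G where "gauss_rule (step_df S w) k G"
proof -
  have int: "(LINT x|interval_measure (step_df S w). poly q x) = (\<Sum>t\<in>S. w t * poly q t)" for q
    using assms by (intro integral_poly_step_df) (auto intro: less_imp_le)
  obtain p where p: "p \<noteq> 0" "degree p = k"
    and orth: "\<And>q. degree q < k \<Longrightarrow> (\<Sum>t\<in>S. w t * (poly p t * poly q t)) = 0"
    using discrete_orthogonal_poly_exists[of S w k] assms by (metis less_imp_le)
  let ?Z = "{t. poly p t = 0}"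
  have Z: "card ?Z = k"
    using orthogonal_poly_roots(2)[of S w k a b p] assms p orth by blast
  with k have "0 < card ?Z" by simp
  then have "finite ?Z" "?Z \<noteq> {}" by (simp_all add: card_gt_0_iff)
  define L where "L = (\<lambda>q. \<Sum>t\<in>S. w t * poly q t)"
  have L: "L (q + q') = L q + L q'" "L (Polynomial.smult c q) = c * L q" for q q' c
    by (simp_all add: L_def sum.distrib sum_distrib_left algebra_simps)
  obtain v where v: "\<And>q. degree q < card ?Z \<Longrightarrow> (\<Sum>t\<in>?Z. v t * poly q t) = L q"
    using interpolatory_weights_exist[of L, OF L \<open>finite ?Z\<close> \<open>?Z \<noteq> {}\<close>] by blast
  have "orthogonal_poly (step_df S w) k p"
    unfolding orthogonal_poly_def poly_mult[symmetric] int
    using p orth by simp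
  moreover have "(\<Sum>t\<in>?Z. v t * poly q t) = (LINT x|interval_measure (step_df S w). poly q x)"
    if "degree q \<le> k - 1" for q
    unfolding int using v[of q] that Z k by (simp add: L_def)
  ultimately have "gauss_rule (step_df S w) k (step_df ?Z v)"
    unfolding gauss_rule_def step_df_def by blast
  then show thesis by (rule that)
qed

text \<open>Exactness up to degree \<open>2k - 1\<close> comes from division by \<open>p\<close>: the quotient has degree less than \<open>k\<close> and is
  killed by orthogonality, while \<open>p\<close> itself vanishes at the nodes. Applied to the square of
  \<open>\<Prod>z\<noteq>t. (x - z)\<close>, this exactness shows that the weight at \<open>t\<close> is nonnegative.\<close>

lemma gauss_rule_step_df:
  assumes "finite S" and w: "\<And>t. t \<in> S \<Longrightarrow> 0 < w t" and "S \<subseteq> {a..b}"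
    and k: "0 < k" "k < card S"
    and G: "gauss_rule (step_df S w) k G"
  obtains Z v where "finite Z" "Z \<subseteq> {a..b}" "\<And>t. t \<in> Z \<Longrightarrow> 0 \<le> v t" "G = step_df Z v"
    "\<And>q. degree q \<le> 2 * k - 1 \<Longrightarrow> (\<Sum>t\<in>Z. v t * poly q t) = (\<Sum>t\<in>S. w t * poly q t)"
proof -
  have int: "(LINT x|interval_measure (step_df S w). poly q x) = (\<Sum>t\<in>S. w t * poly q t)" for q
    using assms by (intro integral_poly_step_df) (auto intro: less_imp_le)
  obtain p v where orth_p: "orthogonal_poly (step_df S w) k p"
    and v: "\<And>q. degree q \<le> k - 1 \<Longrightarrow> (\<Sum>t | poly p t = 0. v t * poly q t) = (\<Sum>t\<in>S. w t * poly q t)"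
    and G_eq: "G = (\<lambda>x. \<Sum>t | poly p t = 0. v t * indicator {t..} x)"
    using G unfolding gauss_rule_def int by blast
  let ?Z = "{t. poly p t = 0}"
  have p: "p \<noteq> 0" "degree p = k"
    and orth: "\<And>q. degree q < k \<Longrightarrow> (\<Sum>t\<in>S. w t * (poly p t * poly q t)) = 0"
    using orth_p unfolding orthogonal_poly_def poly_mult[symmetric] int by auto
  have Z: "?Z \<subseteq> {a..b}" "card ?Z = k"
    using orthogonal_poly_roots[of S w k a b p] assms(1-5) p orth by blast+
  have "finite ?Z" using p by (simp add: poly_roots_finite)
  have exact: "(\<Sum>t\<in>?Z. v t * poly q t) = (\<Sum>t\<in>S. w t * poly q t)"
    if q: "degree q \<le> 2 * k - 1" for q
  proof -
    define h r where "h = q div p" and "r = q mod p"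
    have qhr: "q = p * h + r" by (simp add: h_def r_def)
    have r: "degree r \<le> k - 1"
      using degree_mod_less[OF p(1), of q] p k by (auto simp: r_def)
    have h: "degree h < k"
    proof (cases "h = 0")
      case False
      have "degree (p * h) = degree p + degree h" using p False by (intro degree_mult_eq)
      moreover have "degree (p * h) \<le> 2 * k - 1"
      proof -
        have "p * h = q - r" using qhr by simp
        then show ?thesis using degree_diff_le[of q "2 * k - 1" r] q r by simp
      qed
      ultimately show ?thesis using p k by linarith
    qed (use k in simp)
    have "(\<Sum>t\<in>?Z. v t * poly q t) = (\<Sum>t\<in>?Z. v t * poly r t)"
      by (intro sum.cong) (auto simp: qhr)
    also have "\<dots> = (\<Sum>t\<in>S. w t * poly r t)" using r by (rule v)
    also have "\<dots> = (\<Sum>t\<in>S. w t * (poly p t * poly h t)) + (\<Sum>t\<in>S. w t * poly r t)"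
      using orth[OF h] by simp
    also have "\<dots> = (\<Sum>t\<in>S. w t * poly q t)"
      by (simp add: qhr sum.distrib algebra_simps)
    finally show ?thesis .
  qed
  have "0 \<le> v t" if t: "t \<in> ?Z" for t
  proof -
    define l where "l = (\<Prod>z\<in>?Z - {t}. [:- z, 1:])"
    have l: "poly l z = 0 \<longleftrightarrow> z \<in> ?Z - {t}" for z
      unfolding l_def using \<open>finite ?Z\<close> by (simp add: poly_prod)
    have "degree l = k - 1"
      unfolding l_def using Z t \<open>finite ?Z\<close> by (subst degree_prod_eq_sum_degree) auto
    then have "degree (l * l) \<le> 2 * k - 1"
      using degree_mult_le[of l l] k by linarith
    then have "(\<Sum>z\<in>?Z. v z * poly (l * l) z) = (\<Sum>z\<in>S. w z * poly (l * l) z)" by (rule exact)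
    also have "(\<Sum>z\<in>?Z. v z * poly (l * l) z) = (\<Sum>z\<in>{t}. v z * poly (l * l) z)"
      using t \<open>finite ?Z\<close> l by (intro sum.mono_neutral_right) auto
    finally have "v t * (poly l t * poly l t) = (\<Sum>z\<in>S. w z * poly (l * l) z)" by simp
    also have "\<dots> \<ge> 0" using w by (intro sum_nonneg mult_nonneg_nonneg) (auto intro: less_imp_le)
    finally have "0 \<le> v t * (poly l t * poly l t)" .
    moreover have "0 < poly l t * poly l t" using l[of t] by (simp add: zero_less_mult_iff) linarith
    ultimately show ?thesis by (simp only: zero_le_mult_iff) linarith
  qed
  then show thesis
    using that[of ?Z v] \<open>finite ?Z\<close> Z(1) G_eq exact by (simp add: step_df_def)
qed

text \<open>With at most \<open>k\<close> support points the rule is the given measure itself. Otherwise a rule exists and, since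
  every rule satisfies \<open>gauss_rule_step_df\<close>, it does not matter which one is selected.\<close>

theorem gauss_quad_step_df:
  assumes "finite S" and w: "\<And>t. t \<in> S \<Longrightarrow> 0 \<le> w t" and "S \<subseteq> {a..b}" and "odd s"
  shows "\<exists>Z v. finite Z \<and> Z \<subseteq> {a..b} \<and> (\<forall>t\<in>Z. 0 \<le> v t) \<and>
    gauss_quad (step_df S w) s = step_df Z v \<and>
    (\<forall>q. degree q \<le> s \<longrightarrow> (\<Sum>t\<in>Z. v t * poly q t) = (\<Sum>t\<in>S. w t * poly q t))"
proof -
  \<comment> \<open>Atoms of weight zero do not belong to the support and are discarded.\<close>
  define S' where "S' = {t \<in> S. w t \<noteq> 0}"
  have S': "finite S'" "S' \<subseteq> {a..b}" "\<And>t. t \<in> S' \<Longrightarrow> 0 < w t"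
    using assms by (auto simp: S'_def less_le)
  have sum_S': "(\<Sum>t\<in>S. w t * g t) = (\<Sum>t\<in>S'. w t * g t)" for g
    using \<open>finite S\<close> by (intro sum.mono_neutral_right) (auto simp: S'_def)
  have step_S': "step_df S w = step_df S' w"
    by (simp add: step_df_def sum_S' fun_eq_iff)
  define k where "k = (s + 1) div 2"
  have k: "0 < k" "2 * k - 1 = s" using \<open>odd s\<close> by (auto simp: k_def elim: oddE)
  show ?thesis
  proof (cases "finite (df_support (step_df S w)) \<and> card (df_support (step_df S w)) \<le> k")
    case True
    then have "gauss_quad (step_df S w) s = step_df S w"
      by (simp add: gauss_quad_def k_def)
    then show ?thesis using assms by blast
  next
    case False
    then have eq: "gauss_quad (step_df S w) s = (SOME G. gauss_rule (step_df S' w) k G)"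
      unfolding gauss_quad_def k_def[symmetric] Let_def step_S' by (rule if_not_P)
    have "df_support (step_df S w) \<subseteq> S'"
      unfolding step_S' using S'(1) by (rule df_support_step_df_subset)
    with False S'(1) have "k < card S'"
      by (meson card_mono finite_subset le_trans not_le)
    then have "gauss_rule (step_df S' w) k (gauss_quad (step_df S w) s)"
      unfolding eq using gauss_rule_exists[of S' w a b k] S' k by (metis someI)
    from gauss_rule_step_df[OF S'(1) _ S'(2) k(1) \<open>k < card S'\<close> this] S'(3)
    obtain Z v where Zv: "finite Z" "Z \<subseteq> {a..b}" "\<And>t. t \<in> Z \<Longrightarrow> 0 \<le> v t"
        "gauss_quad (step_df S w) s = step_df Z v"
        "\<And>q. degree q \<le> 2 * k - 1 \<Longrightarrow> (\<Sum>t\<in>Z. v t * poly q t) = (\<Sum>t\<in>S'. w t * poly q t)"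
      by blast
    show ?thesis
      using Zv unfolding k(2) sum_S' by blast
  qed
qed

section \<open>Chebyshev polynomials\<close>

fun cheb :: "nat \<Rightarrow> real poly" where
  "cheb 0 = 1"
| "cheb (Suc 0) = [:0, 1:]"
| "cheb (Suc (Suc n)) = [:0, 2:] * cheb (Suc n) - cheb n"

lemma poly_cheb_cos: "poly (cheb n) (cos t) = cos (real n * t)"
proof (induction n rule: cheb.induct)
  case (3 n)
  have "cos (real (Suc (Suc n)) * t) + cos (real n * t) = 2 * cos t * cos (real (Suc n) * t)"
    using cos_add[of "real (Suc n) * t" t] cos_diff[of "real (Suc n) * t" t]
    by (simp add: algebra_simps)
  then show ?case using 3 by simp
qed simp_all

lemma degree_cheb_le: "degree (cheb n) \<le> n"
proof (induction n rule: cheb.induct)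
  case (3 n)
  have "degree ([:0, 2:] * cheb (Suc n)) \<le> 1 + degree (cheb (Suc n))"
    by (rule order.trans[OF degree_mult_le]) simp
  then show ?case using 3 by (simp only: cheb.simps) (intro degree_diff_le; linarith)
qed simp_all

lemma abs_poly_cheb_le_1:
  assumes "\<bar>x\<bar> \<le> 1"
  shows "\<bar>poly (cheb n) x\<bar> \<le> 1"
  using poly_cheb_cos[of n "arccos x"] assms by (simp add: cos_arccos_abs)

lemma poly_cheb_1: "poly (cheb n) 1 = 1"
  using poly_cheb_cos[of n 0] by simp

section \<open>The Joukowski map and Bernstein ellipses\<close>

definition joukowski :: "complex \<Rightarrow> complex" where
  "joukowski u = (u + inverse u) / 2"

text \<open>The Bernstein ellipse of \<open>[-1, 1]\<close>, in terms of its foci \<open>\<plusminus>1\<close>. This form makes it evident that the region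
  is open and convex.\<close>

definition ellipse_pm1 :: "real \<Rightarrow> complex set" where
  "ellipse_pm1 \<rho> = {z. norm (z - 1) + norm (z + 1) < \<rho> + inverse \<rho>}"

text \<open>With \<open>u = s\<^sup>2\<close> the two distances are \<open>|s \<mp> 1/s|\<^sup>2 / 2\<close>, and the parallelogram law adds them up.\<close>

lemma joukowski_focal_sum:
  assumes "u \<noteq> 0"
  shows "norm (joukowski u - 1) + norm (joukowski u + 1) = norm u + inverse (norm u)"
proof -
  have parallelogram: "(norm (x - y))\<^sup>2 + (norm (x + y))\<^sup>2 = 2 * ((norm x)\<^sup>2 + (norm y)\<^sup>2)"
    for x y :: complex
    unfolding cmod_power2 by (simp add: power2_eq_square algebra_simps)
  define s where "s = csqrt u"
  have s: "s\<^sup>2 = u" "s \<noteq> 0" using assms by (auto simp: s_def)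
  have "joukowski u - 1 = (s - inverse s)\<^sup>2 / 2" "joukowski u + 1 = (s + inverse s)\<^sup>2 / 2"
    unfolding joukowski_def s(1)[symmetric] using s(2)
    by (simp_all add: power2_eq_square field_simps)
  then have "norm (joukowski u - 1) + norm (joukowski u + 1)
      = norm ((s - inverse s)\<^sup>2 / 2) + norm ((s + inverse s)\<^sup>2 / 2)"
    by (simp only:)
  also have "\<dots> = ((norm (s - inverse s))\<^sup>2 + (norm (s + inverse s))\<^sup>2) / 2"
    by (simp add: norm_divide norm_power)
  also have "\<dots> = (norm s)\<^sup>2 + (norm (inverse s))\<^sup>2"
    using parallelogram[of s "inverse s"] by simp
  also have "\<dots> = norm u + inverse (norm u)"
    by (simp add: s(1)[symmetric] norm_power norm_inverse power_inverse)
  finally show ?thesis .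
qed

text \<open>The two preimages of \<open>z\<close> are \<open>z \<plusminus> \<surd>(z\<^sup>2 - 1)\<close>. Their product is \<open>1\<close>, so one of them has modulus at least \<open>1\<close>.\<close>

lemma joukowski_surj:
  obtains u where "1 \<le> norm u" "joukowski u = z"
proof -
  define d where "d = csqrt (z\<^sup>2 - 1)"
  have prod1: "(z + d) * (z - d) = 1"
    by (simp add: d_def algebra_simps flip: power2_eq_square)
  then have inv: "inverse (z + d) = z - d" "inverse (z - d) = z + d"
    using inverse_unique[OF prod1] inverse_unique[of "z - d" "z + d"] by (simp_all add: mult.commute)
  have J: "joukowski (z + d) = z" "joukowski (z - d) = z"
    by (simp_all add: joukowski_def inv)
  have "norm (z + d) * norm (z - d) = 1" using prod1 by (metis norm_mult norm_one)
  then have "1 \<le> norm (z + d) \<or> 1 \<le> norm (z - d)"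
    using mult_left_le[of "norm (z - d)" "norm (z + d)"] norm_ge_zero[of "z + d"] by linarith
  then show thesis using J that by blast
qed

lemma add_inverse_less_iff:
  fixes r \<rho> :: real
  assumes "1 \<le> r" "1 < \<rho>"
  shows "r + inverse r < \<rho> + inverse \<rho> \<longleftrightarrow> r < \<rho>"
proof -
  have "1 < r * \<rho>" using assms mult_right_mono[of 1 r \<rho>] by linarith
  have "(\<rho> + inverse \<rho>) - (r + inverse r) = (\<rho> - r) * (1 - inverse (r * \<rho>))"
    using assms by (simp add: field_simps)
  moreover have "0 < 1 - inverse (r * \<rho>)" using \<open>1 < r * \<rho>\<close> by (simp add: inverse_less_1_iff del: inverse_mult_distrib)
  ultimately have "0 < (\<rho> + inverse \<rho>) - (r + inverse r) \<longleftrightarrow> 0 < \<rho> - r"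
    by (simp only: zero_less_mult_iff) auto
  then show ?thesis by simp
qed

lemma joukowski_image_annulus:
  assumes "1 < \<rho>"
  shows "joukowski ` {u. 1 \<le> norm u \<and> norm u < \<rho>} = ellipse_pm1 \<rho>"
proof (intro equalityI subsetI)
  fix z assume "z \<in> joukowski ` {u. 1 \<le> norm u \<and> norm u < \<rho>}"
  then obtain u where u: "z = joukowski u" "1 \<le> norm u" "norm u < \<rho>" by auto
  then have "u \<noteq> 0" by auto
  then show "z \<in> ellipse_pm1 \<rho>"
    using u joukowski_focal_sum[of u] add_inverse_less_iff[of "norm u" \<rho>] assms
    by (simp add: ellipse_pm1_def)
next
  fix z assume z: "z \<in> ellipse_pm1 \<rho>"
  obtain u where u: "1 \<le> norm u" "joukowski u = z" by (rule joukowski_surj)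
  then have "u \<noteq> 0" by auto
  then have "norm u < \<rho>"
    using u z joukowski_focal_sum[of u] add_inverse_less_iff[of "norm u" \<rho>] assms
    by (simp add: ellipse_pm1_def)
  then show "z \<in> joukowski ` {u. 1 \<le> norm u \<and> norm u < \<rho>}" using u by blast
qed

lemma open_ellipse_pm1: "open (ellipse_pm1 \<rho>)"
  unfolding ellipse_pm1_def by (intro open_Collect_less continuous_intros)

lemma convex_ellipse_pm1: "convex (ellipse_pm1 \<rho>)"
proof (rule convexI)
  fix x y :: complex and u v :: real
  assume xy: "x \<in> ellipse_pm1 \<rho>" "y \<in> ellipse_pm1 \<rho>" and uv: "0 \<le> u" "0 \<le> v" "u + v = 1"
  have tri: "norm (u *\<^sub>R x + v *\<^sub>R y + c) \<le> u * norm (x + c) + v * norm (y + c)" for c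
  proof -
    have "c = u *\<^sub>R c + v *\<^sub>R c" using uv(3) by (simp flip: scaleR_add_left)
    then have "u *\<^sub>R x + v *\<^sub>R y + c = u *\<^sub>R (x + c) + v *\<^sub>R (y + c)"
      by (simp add: scaleR_add_right)
    then show ?thesis
      using norm_triangle_ineq[of "u *\<^sub>R (x + c)" "v *\<^sub>R (y + c)"] uv by simp
  qed
  let ?R = "\<rho> + inverse \<rho>" and ?n = "\<lambda>z :: complex. norm (z - 1) + norm (z + 1)"
  have "?n (u *\<^sub>R x + v *\<^sub>R y) \<le> u * ?n x + v * ?n y"
    using tri[of "-1"] tri[of 1] by (simp add: algebra_simps)
  also have "\<dots> < ?R"
  proof -
    have "max (?n x) (?n y) < ?R" using xy by (simp add: ellipse_pm1_def)
    moreover have "u * ?n x + v * ?n y \<le> u * max (?n x) (?n y) + v * max (?n x) (?n y)"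
      using uv by (intro add_mono mult_left_mono) auto
    moreover have "\<dots> = max (?n x) (?n y)"
      using uv(3) by (simp flip: distrib_right)
    ultimately show ?thesis by linarith
  qed
  finally show "u *\<^sub>R x + v *\<^sub>R y \<in> ellipse_pm1 \<rho>" by (simp add: ellipse_pm1_def)
qed

section \<open>Chebyshev approximation of analytic functions\<close>

text \<open>The Cauchy kernel of the ellipse in the coordinate \<open>u\<close>, that is \<open>J'(u) / (J u - J w)\<close> for the Joukowski map
  \<open>J\<close>, in partial fractions.\<close>

definition joukowski_kernel :: "complex \<Rightarrow> complex \<Rightarrow> complex" where
  "joukowski_kernel w u = 1 / (u - w) + 1 / (u - inverse w) - 1 / u"

lemma joukowski_diff:
  assumes "u \<noteq> 0" "w \<noteq> 0"
  shows "joukowski u - joukowski w = (u - w) * (u - inverse w) / (2 * u)"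
  using assms by (simp add: joukowski_def field_simps)

lemma has_field_derivative_joukowski:
  assumes "u \<noteq> 0"
  shows "(joukowski has_field_derivative (1 - inverse (u\<^sup>2)) / 2) (at u within S)"
  using DERIV_cdivide[OF DERIV_add[OF DERIV_ident DERIV_inverse[OF assms]], where c = 2]
  by (simp add: joukowski_def[abs_def] power2_eq_square)

lemma joukowski_kernel_eq:
  assumes "u \<noteq> 0" "w \<noteq> 0" "u \<noteq> w" "u \<noteq> inverse w"
  shows "joukowski_kernel w u = ((1 - inverse (u\<^sup>2)) / 2) / (joukowski u - joukowski w)"
proof -
  define v where "v = inverse w"
  have vw: "w * v = 1" "u \<noteq> v" using assms by (auto simp: v_def)
  have nz: "u - w \<noteq> 0" "u - v \<noteq> 0" using assms vw by auto
  have "joukowski_kernel w u = (u * (u - v) + u * (u - w) - (u - w) * (u - v)) / (u * ((u - w) * (u - v)))"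
    unfolding joukowski_kernel_def v_def[symmetric] using nz assms(1) by (simp add: divide_simps) (simp add: algebra_simps)
  also have "u * (u - v) + u * (u - w) - (u - w) * (u - v) = u\<^sup>2 - 1"
    using vw by (simp add: algebra_simps power2_eq_square)
  also have "(u\<^sup>2 - 1) / (u * ((u - w) * (u - v))) = ((1 - inverse (u\<^sup>2)) / 2) / ((u - w) * (u - v) / (2 * u))"
    using nz assms(1) by (simp add: divide_simps power2_eq_square)
  finally show ?thesis
    unfolding joukowski_diff[OF assms(1,2)] v_def .
qed

lemma joukowski_kernel_integral:
  assumes w: "norm w = 1" and r: "1 < r"
  shows "(joukowski_kernel w has_contour_integral 2 * of_real pi * \<i>) (circlepath 0 r)"
proof -
  have int: "((\<lambda>u. 1 / (u - c)) has_contour_integral 2 * of_real pi * \<i>) (circlepath 0 r)"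
    if "norm c < r" for c
    using Cauchy_integral_circlepath_simple[of "\<lambda>_. 1" 0 r c] that by simp
  have "((\<lambda>u. 1 / (u - w) + 1 / (u - inverse w) - 1 / (u - 0)) has_contour_integral
      2 * of_real pi * \<i> + 2 * of_real pi * \<i> - 2 * of_real pi * \<i>) (circlepath 0 r)"
    using assms by (intro has_contour_integral_add has_contour_integral_diff int) (auto simp: norm_inverse)
  then show ?thesis by (simp add: joukowski_kernel_def[abs_def] mult_ac)
qed

lemma joukowski_in_ellipse:
  assumes "1 \<le> norm u" "norm u < \<rho>" "1 < \<rho>"
  shows "joukowski u \<in> ellipse_pm1 \<rho>"
  using joukowski_image_annulus[of \<rho>] assms by blast

text \<open>Splitting off the constant \<open>F (J w)\<close> leaves an integrand \<open>G(J u) J'(u)\<close>, where \<open>G\<close> is the difference quotient of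
  \<open>F\<close> at \<open>J w\<close>, with its singularity removed. On the convex ellipse \<open>G\<close> has a primitive, so this part
  integrates to \<open>0\<close> over the closed circle. Thus no winding number of an ellipse has to be computed.\<close>

lemma joukowski_Cauchy_formula:
  assumes F: "F holomorphic_on ellipse_pm1 \<rho>" and w: "norm w = 1" and r: "1 < r" "r < \<rho>"
  shows "((\<lambda>u. F (joukowski u) * joukowski_kernel w u) has_contour_integral
           2 * of_real pi * \<i> * F (joukowski w)) (circlepath 0 r)"
proof -
  let ?E = "ellipse_pm1 \<rho>" and ?c = "circlepath 0 r"
  define x where "x = joukowski w"
  \<comment> \<open>The value at \<open>x\<close> removes the singularity of the difference quotient.\<close>
  define G where "G = (\<lambda>z. if z = x then deriv F x else (F z - F x) / (z - x))"
  have "G holomorphic_on ?E"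
    unfolding G_def using F open_ellipse_pm1 by (rule pole_lemma_open)
  then obtain H where H: "\<And>z. z \<in> ?E \<Longrightarrow> (H has_field_derivative G z) (at z within ?E)"
    using holomorphic_convex_primitive'[OF convex_ellipse_pm1 open_ellipse_pm1] by metis
  have H': "(H has_field_derivative G z) (at z)" if "z \<in> ?E" for z
    using H[OF that] at_within_open[OF that open_ellipse_pm1] by simp
  have on_circle: "joukowski u \<in> ?E" "u \<noteq> 0" "u \<noteq> w" "u \<noteq> inverse w" if "norm u = r" for u
    using that r w by (auto intro: joukowski_in_ellipse simp: norm_inverse)
  have "w \<noteq> 0" using w by auto
  have "((\<lambda>u. G (joukowski u) * ((1 - inverse (u\<^sup>2)) / 2)) has_contour_integral
      (H \<circ> joukowski) (pathfinish ?c) - (H \<circ> joukowski) (pathstart ?c)) ?c"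
  proof (rule contour_integral_primitive[where S = "sphere 0 r"])
    fix u :: complex assume "u \<in> sphere 0 r"
    then have "norm u = r" by simp
    then show "(H \<circ> joukowski has_field_derivative G (joukowski u) * ((1 - inverse (u\<^sup>2)) / 2)) (at u within sphere 0 r)"
      using on_circle by (intro DERIV_chain' [THEN DERIV_subset] DERIV_chain has_field_derivative_joukowski H') auto
  qed (use r in auto)
  then have "((\<lambda>u. G (joukowski u) * ((1 - inverse (u\<^sup>2)) / 2)) has_contour_integral 0) ?c" by simp
  then have "((\<lambda>u. (F (joukowski u) - F x) * joukowski_kernel w u) has_contour_integral 0) ?c"
  proof (rule has_contour_integral_eq)
    fix u assume "u \<in> path_image ?c"
    then have u: "norm u = r" using r by simp
    have "joukowski u - x \<noteq> 0"
      unfolding x_def joukowski_diff[OF on_circle(2)[OF u] \<open>w \<noteq> 0\<close>] using on_circle[OF u] by simp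
    then show "G (joukowski u) * ((1 - inverse (u\<^sup>2)) / 2) = (F (joukowski u) - F x) * joukowski_kernel w u"
      unfolding joukowski_kernel_eq[OF on_circle(2)[OF u] \<open>w \<noteq> 0\<close> on_circle(3,4)[OF u]] G_def x_def[symmetric]
      by simp
  qed
  from has_contour_integral_add[OF this
      has_contour_integral_lmul[OF joukowski_kernel_integral[OF w r(1)], of "F x"]]
  show ?thesis by (simp add: x_def algebra_simps)
qed

lemma truncated_geometric:
  fixes u w :: "'a::field"
  assumes "u \<noteq> 0" "u \<noteq> w"
  shows "1 / (u - w) = (\<Sum>j<N. w ^ j / u ^ Suc j) + (w / u) ^ N / (u - w)"
proof (induction N)
  case (Suc N)
  have "(w / u) ^ N / (u - w) = w ^ N / u ^ Suc N + (w / u) ^ Suc N / (u - w)"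
  proof -
    have "1 / (u - w) = 1 / u + (w / u) / (u - w)"
      using assms by (simp add: divide_simps)
    then have "(w / u) ^ N * (1 / (u - w)) = (w / u) ^ N * (1 / u + (w / u) / (u - w))" by simp
    then show ?thesis by (simp add: distrib_left power_divide mult_ac)
  qed
  then show ?case using Suc by simp
qed simp

text \<open>For \<open>x = J w\<close> with \<open>|w| = 1\<close>, the two geometric series of the kernel, in powers of \<open>w/u\<close> and
  \<open>1/(wu)\<close>, combine to
  \<open>w\<^sup>j + w\<^sup>-\<^sup>j = 2 T\<^sub>j(x)\<close>, so that truncating them after \<open>j = s\<close> gives the Chebyshev sum. The coefficients are
  integrals over the circle and the remainder is estimated there too; both bounds use only \<open>|F| \<le> M\<close>.
  The coefficients do not depend on \<open>s\<close> or \<open>x\<close>.\<close>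

theorem chebyshev_approximation:
  assumes F: "F holomorphic_on ellipse_pm1 \<rho>" and M: "\<And>z. z \<in> ellipse_pm1 \<rho> \<Longrightarrow> norm (F z) \<le> M"
    and r: "1 < r" "r < \<rho>"
  obtains a where "\<And>j. norm (a j) \<le> 2 * M / r ^ j"
    "\<And>x s. \<bar>x\<bar> \<le> 1 \<Longrightarrow>
      norm (F (of_real x) - (\<Sum>j\<le>s. a j * of_real (poly (cheb j) x))) \<le> 2 * M / (r ^ s * (r - 1))"
proof -
  let ?c = "circlepath 0 r"
  define I where "I = (\<lambda>j. contour_integral ?c (\<lambda>u. F (joukowski u) / u ^ Suc j))"
  \<comment> \<open>The Chebyshev series counts \<open>T\<^sub>0\<close> once and the other \<open>T\<^sub>j\<close> twice.\<close>
  define e where "e = (\<lambda>j::nat. if j = 0 then 1 else 2 :: complex)"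
  define a where "a = (\<lambda>j. e j * I j / (2 * of_real pi * \<i>))"
  have in_E: "joukowski u \<in> ellipse_pm1 \<rho>" if "norm u = r" for u
    using that r by (intro joukowski_in_ellipse) auto
  have "norm (F (joukowski (of_real r))) \<le> M" using r by (intro M in_E) simp
  then have "0 \<le> M" by (rule order.trans[OF norm_ge_zero])
  have cont: "continuous_on (path_image ?c) (\<lambda>u. F (joukowski u))"
  proof (rule continuous_on_compose2[OF holomorphic_on_imp_continuous_on[OF F]])
    show "continuous_on (path_image ?c) joukowski"
      unfolding joukowski_def[abs_def] using r by (intro continuous_intros) auto
    show "joukowski ` path_image ?c \<subseteq> ellipse_pm1 \<rho>"
      using r in_E by auto
  qed
  have I: "((\<lambda>u. F (joukowski u) / u ^ Suc j) has_contour_integral I j) ?c" for j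
    unfolding I_def
    by (intro has_contour_integral_integral contour_integrable_continuous_circlepath
        continuous_intros cont) (use r in auto)
  have norm_I: "norm (I j) \<le> 2 * pi * M / r ^ j" for j
  proof -
    have "norm (I j) \<le> M / r ^ Suc j * (2 * pi * r)"
    proof (rule has_contour_integral_bound_circlepath[OF I])
      fix u :: complex assume "norm (u - 0) = r"
      then show "norm (F (joukowski u) / u ^ Suc j) \<le> M / r ^ Suc j"
        using M[OF in_E[of u]] r by (simp add: norm_divide norm_power norm_mult divide_right_mono)
    qed (use \<open>0 \<le> M\<close> r in auto)
    then show ?thesis using r by (simp add: field_simps)
  qed
  show thesis
  proof (rule that[of a])
    fix j
    have "norm (a j) = norm (e j) * norm (I j) / (2 * pi)"
      by (simp add: a_def norm_mult norm_divide)
    also have "\<dots> \<le> 2 * (2 * pi * M / r ^ j) / (2 * pi)"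
      using norm_I[of j] by (intro divide_right_mono mult_mono) (auto simp: e_def)
    finally show "norm (a j) \<le> 2 * M / r ^ j" by (simp add: field_simps)
  next
    fix x :: real and s assume x: "\<bar>x\<bar> \<le> 1"
    define \<theta> where "\<theta> = arccos x"
    define w where "w = cis \<theta>"
    have w: "norm w = 1" "w \<noteq> 0" by (auto simp: w_def)
    have Jw: "joukowski w = of_real x"
      using x by (simp add: joukowski_def w_def \<theta>_def complex_eq_iff cos_arccos_abs)
    have pow_w: "w ^ j + inverse w ^ j = 2 * of_real (poly (cheb j) x)" for j
    proof -
      have "x = cos \<theta>" using x by (simp add: \<theta>_def cos_arccos_abs)
      then have "poly (cheb j) x = cos (real j * \<theta>)" by (simp add: poly_cheb_cos)
      moreover have "w ^ j = cis (real j * \<theta>)" "inverse w ^ j = cis (- (real j * \<theta>))"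
        by (simp_all add: w_def Complex.DeMoivre)
      ultimately show ?thesis by (simp add: complex_eq_iff)
    qed
    define R where "R = (\<lambda>u. (w / u) ^ Suc s / (u - w) + (inverse w / u) ^ Suc s / (u - inverse w))"
    have kernel: "joukowski_kernel w u
        = (\<Sum>j\<le>s. e j * of_real (poly (cheb j) x) / u ^ Suc j) + R u" if u: "norm u = r" for u
    proof -
      have nz: "u \<noteq> 0" "u \<noteq> w" "u \<noteq> inverse w"
        using u r w(1) by (auto simp: norm_inverse)
      have "1 / (u - w) + 1 / (u - inverse w)
          = (\<Sum>j\<le>s. (w ^ j + inverse w ^ j) / u ^ Suc j) + R u"
        unfolding truncated_geometric[OF nz(1,2), of "Suc s"] truncated_geometric[OF nz(1,3), of "Suc s"]
        by (simp add: R_def lessThan_Suc_atMost add_divide_distrib sum.distrib del: sum.lessThan_Suc)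
      moreover have "(\<Sum>j\<le>s. (w ^ j + inverse w ^ j) / u ^ Suc j)
          = (\<Sum>j\<le>s. e j * of_real (poly (cheb j) x) / u ^ Suc j) + 1 / u"
        unfolding pow_w by (simp add: sum.atMost_shift e_def)
      ultimately show ?thesis by (simp add: joukowski_kernel_def)
    qed
    have norm_R: "norm (R u) \<le> 2 / (r ^ Suc s * (r - 1))" if u: "norm u = r" for u
    proof -
      have one: "norm ((c / u) ^ Suc s / (u - c)) \<le> 1 / (r ^ Suc s * (r - 1))" if c: "norm c = 1" for c
      proof -
        have "r - 1 \<le> norm (u - c)" using norm_triangle_ineq2[of u c] u c by simp
        then have "1 / r ^ Suc s / norm (u - c) \<le> 1 / r ^ Suc s / (r - 1)"
          using r by (intro divide_left_mono mult_pos_pos) auto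
        then show ?thesis using u c by (simp add: norm_divide norm_power norm_mult power_divide)
      qed
      have "norm (R u) \<le> 1 / (r ^ Suc s * (r - 1)) + 1 / (r ^ Suc s * (r - 1))"
        unfolding R_def using w by (intro norm_triangle_mono one) (auto simp: norm_inverse)
      then show ?thesis by (simp add: mult_ac)
    qed
    have sum_int: "((\<lambda>u. \<Sum>j\<le>s. (e j * of_real (poly (cheb j) x)) * (F (joukowski u) / u ^ Suc j))
        has_contour_integral (\<Sum>j\<le>s. (e j * of_real (poly (cheb j) x)) * I j)) ?c"
      by (intro has_contour_integral_sum has_contour_integral_lmul I) simp
    have sum_eq: "(\<Sum>j\<le>s. (e j * of_real (poly (cheb j) x)) * I j)
        = 2 * of_real pi * \<i> * (\<Sum>j\<le>s. a j * of_real (poly (cheb j) x))"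
      by (simp add: a_def sum_distrib_left mult_ac)
    have "((\<lambda>u. F (joukowski u) * joukowski_kernel w u
          - (\<Sum>j\<le>s. (e j * of_real (poly (cheb j) x)) * (F (joukowski u) / u ^ Suc j)))
        has_contour_integral 2 * of_real pi * \<i> * (F (of_real x) - (\<Sum>j\<le>s. a j * of_real (poly (cheb j) x)))) ?c"
      using has_contour_integral_diff[OF joukowski_Cauchy_formula[OF F w(1) r] sum_int]
      unfolding Jw sum_eq by (simp only: right_diff_distrib)
    then have "norm (2 * of_real pi * \<i> * (F (of_real x) - (\<Sum>j\<le>s. a j * of_real (poly (cheb j) x))))
        \<le> M * (2 / (r ^ Suc s * (r - 1))) * (2 * pi * r)"
    proof (rule has_contour_integral_bound_circlepath)
      fix u :: complex assume "norm (u - 0) = r"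
      then have u: "norm u = r" by simp
      have "F (joukowski u) * joukowski_kernel w u
          - (\<Sum>j\<le>s. (e j * of_real (poly (cheb j) x)) * (F (joukowski u) / u ^ Suc j)) = F (joukowski u) * R u"
        unfolding kernel[OF u] by (simp add: algebra_simps sum_distrib_left)
      then show "norm (F (joukowski u) * joukowski_kernel w u
          - (\<Sum>j\<le>s. (e j * of_real (poly (cheb j) x)) * (F (joukowski u) / u ^ Suc j)))
          \<le> M * (2 / (r ^ Suc s * (r - 1)))"
        using M[OF in_E[OF u]] norm_R[OF u] \<open>0 \<le> M\<close> by (simp only: norm_mult) (intro mult_mono, auto)
    qed (use \<open>0 \<le> M\<close> r in auto)
    moreover have "norm (2 * of_real pi * \<i> * X) = 2 * pi * norm X" for X :: complex
      by (simp add: norm_mult)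
    moreover have "M * (2 / (r ^ Suc s * (r - 1))) * (2 * pi * r) = 2 * pi * (2 * M / (r ^ s * (r - 1)))"
      using r by (simp add: field_simps)
    ultimately have "2 * pi * norm (F (of_real x) - (\<Sum>j\<le>s. a j * of_real (poly (cheb j) x)))
        \<le> 2 * pi * (2 * M / (r ^ s * (r - 1)))" by (simp only:)
    then show "norm (F (of_real x) - (\<Sum>j\<le>s. a j * of_real (poly (cheb j) x))) \<le> 2 * M / (r ^ s * (r - 1))"
      by (rule mult_left_le_imp_le) simp
  qed
qed

section \<open>The class Anl on the spectral interval\<close>

definition ellipse_map :: "real \<Rightarrow> real \<Rightarrow> complex \<Rightarrow> complex" where
  "ellipse_map a b z = of_real ((a + b) / 2) + ((b - a) / 2) *\<^sub>R z"

definition scaled_cheb :: "real \<Rightarrow> real \<Rightarrow> nat \<Rightarrow> real poly" where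
  "scaled_cheb a b j = pcompose (cheb j) [:- (a + b) / (b - a), 2 / (b - a):]"

lemma bernstein_ellipse_eq:
  assumes "1 < \<rho>"
  shows "bernstein_ellipse \<rho> a b = ellipse_map a b ` ellipse_pm1 \<rho>"
  unfolding joukowski_image_annulus[OF assms, symmetric] bernstein_ellipse_def image_image
  by (intro image_cong refl) (simp add: ellipse_map_def joukowski_def scaleR_conv_of_real)

lemma open_bernstein_ellipse:
  assumes "1 < \<rho>" "a < b"
  shows "open (bernstein_ellipse \<rho> a b)"
  unfolding bernstein_ellipse_eq[OF assms(1)] ellipse_map_def[abs_def]
  using assms by (intro open_affinity open_ellipse_pm1) simp

lemma
  assumes "a < b" "x \<in> {a..b}"
  shows poly_scaled_cheb: "poly (scaled_cheb a b j) x = poly (cheb j) ((2 * x - a - b) / (b - a))"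
    and abs_rescaled_le: "\<bar>(2 * x - a - b) / (b - a)\<bar> \<le> 1"
    and ellipse_map_rescaled: "ellipse_map a b (of_real ((2 * x - a - b) / (b - a))) = of_real x"
proof -
  have "poly [:- (a + b) / d, 2 / d:] x = (2 * x - a - b) / d" if "d \<noteq> 0" for d
    using that by (simp add: field_simps)
  then have "poly [:- (a + b) / (b - a), 2 / (b - a):] x = (2 * x - a - b) / (b - a)"
    using assms by simp
  then show "poly (scaled_cheb a b j) x = poly (cheb j) ((2 * x - a - b) / (b - a))"
    by (simp only: scaled_cheb_def poly_pcompose)
  show "\<bar>(2 * x - a - b) / (b - a)\<bar> \<le> 1"
    using assms by (auto simp: abs_le_iff field_simps)
  have "(a + b) / 2 + (b - a) / 2 * ((2 * x - a - b) / (b - a)) = x"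
    using assms by (simp add: field_simps)
  then show "ellipse_map a b (of_real ((2 * x - a - b) / (b - a))) = of_real x"
    unfolding ellipse_map_def scaleR_conv_of_real by (metis of_real_add of_real_mult)
qed

lemma scaled_cheb_0: "scaled_cheb a b 0 = 1"
  by (simp add: scaled_cheb_def)

lemma degree_scaled_cheb_le: "degree (scaled_cheb a b j) \<le> j"
  unfolding scaled_cheb_def
  by (rule order.trans[OF degree_pcompose_le]) (use degree_cheb_le[of j] in auto)

lemma abs_scaled_cheb_le_1: "a < b \<Longrightarrow> x \<in> {a..b} \<Longrightarrow> \<bar>poly (scaled_cheb a b j) x\<bar> \<le> 1"
  by (simp only: poly_scaled_cheb abs_poly_cheb_le_1 abs_rescaled_le)

lemma poly_scaled_cheb_right_end: "a < b \<Longrightarrow> poly (scaled_cheb a b j) b = 1"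
  by (simp add: poly_scaled_cheb poly_cheb_1)

lemma interval_subset_bernstein_ellipse:
  assumes "1 < \<rho>" "a < b" "x \<in> {a..b}"
  shows "complex_of_real x \<in> bernstein_ellipse \<rho> a b"
proof -
  define y where "y = (2 * x - a - b) / (b - a)"
  have y: "\<bar>y\<bar> \<le> 1" "ellipse_map a b (of_real y) = of_real x"
    using assms abs_rescaled_le ellipse_map_rescaled by (auto simp: y_def)
  have "norm (complex_of_real y - 1) = \<bar>y - 1\<bar>" "norm (complex_of_real y + 1) = \<bar>y + 1\<bar>"
    by (metis norm_of_real of_real_1 of_real_diff, metis norm_of_real of_real_1 of_real_add)
  then have "of_real y \<in> ellipse_pm1 \<rho>"
    using y(1) add_inverse_less_iff[of 1 \<rho>] assms(1) by (simp add: ellipse_pm1_def)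
  then show ?thesis unfolding bernstein_ellipse_eq[OF assms(1)] using y(2) by (metis imageI)
qed

lemma Anl_approximation:
  assumes ab: "a < b" and f: "f \<in> Anl M \<rho> a b" and r: "1 < r" "r < \<rho>"
  obtains \<alpha> where "\<And>j. norm (\<alpha> j) \<le> 2 * M / r ^ j"
    "\<And>x s. x \<in> {a..b} \<Longrightarrow>
      norm (f (of_real x) - (\<Sum>j\<le>s. \<alpha> j * of_real (poly (scaled_cheb a b j) x))) \<le> 2 * M / (r ^ s * (r - 1))"
proof -
  have "1 < \<rho>" using r by simp
  note eq = bernstein_ellipse_eq[OF this, of a b]
  have "f holomorphic_on bernstein_ellipse \<rho> a b"
    using f by (auto simp: Anl_def intro: analytic_imp_holomorphic)
  then have "f \<circ> ellipse_map a b holomorphic_on ellipse_pm1 \<rho>"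
    unfolding eq by (intro holomorphic_on_compose)
      (auto simp: ellipse_map_def[abs_def] scaleR_conv_of_real intro!: holomorphic_intros)
  moreover have "norm ((f \<circ> ellipse_map a b) z) \<le> M" if "z \<in> ellipse_pm1 \<rho>" for z
    using f that by (auto simp: Anl_def eq)
  ultimately obtain \<alpha> where \<alpha>: "\<And>j. norm (\<alpha> j) \<le> 2 * M / r ^ j"
    and approx: "\<And>y s. \<bar>y\<bar> \<le> 1 \<Longrightarrow> norm ((f \<circ> ellipse_map a b) (of_real y)
        - (\<Sum>j\<le>s. \<alpha> j * of_real (poly (cheb j) y))) \<le> 2 * M / (r ^ s * (r - 1))"
    using chebyshev_approximation[of "f \<circ> ellipse_map a b" \<rho> M r] r by blast
  show thesis
  proof (rule that[OF \<alpha>])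
    fix x s assume x: "x \<in> {a..b}"
    show "norm (f (of_real x) - (\<Sum>j\<le>s. \<alpha> j * of_real (poly (scaled_cheb a b j) x))) \<le> 2 * M / (r ^ s * (r - 1))"
      using approx[OF abs_rescaled_le[OF ab x], of s]
      by (simp only: o_def ellipse_map_rescaled[OF ab x] poly_scaled_cheb[OF ab x])
  qed
qed

text \<open>The Chebyshev approximation is available for every \<open>r < \<rho>\<close>, with coefficients that may depend on \<open>r\<close>.
  The resulting estimate does not mention them, so \<open>r\<close> can tend to \<open>\<rho>\<close> afterwards.\<close>

theorem Anl_functional_bound:
  fixes \<Lambda> :: "(real \<Rightarrow> complex) \<Rightarrow> complex"
  assumes add: "\<And>g h. \<Lambda> (\<lambda>x. g x + h x) = \<Lambda> g + \<Lambda> h" and mult: "\<And>c g. \<Lambda> (\<lambda>x. c * g x) = c * \<Lambda> g"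
    and bound: "\<And>g B. (\<And>x. x \<in> {a..b} \<Longrightarrow> norm (g x) \<le> B) \<Longrightarrow> norm (\<Lambda> g) \<le> 2 * B"
    and const: "\<Lambda> (\<lambda>x. 1) = 0"
    and cheb_small: "\<And>j. 1 \<le> j \<Longrightarrow> j \<le> s \<Longrightarrow> norm (\<Lambda> (\<lambda>x. of_real (poly (scaled_cheb a b j) x))) \<le> \<tau>"
    and ab: "a < b" and "0 < M" "1 < \<rho>" "0 \<le> \<tau>" and f: "f \<in> Anl M \<rho> a b"
  shows "norm (\<Lambda> (\<lambda>x. f (of_real x))) \<le> 2 * M * \<tau> / (\<rho> - 1) + 4 * M / (\<rho> ^ s * (\<rho> - 1))"
proof -
  let ?P = "\<lambda>j x. complex_of_real (poly (scaled_cheb a b j) x)"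
  have zero: "\<Lambda> (\<lambda>x. 0) = 0" using mult[of 0 "\<lambda>_. 0"] by simp
  have sum: "\<Lambda> (\<lambda>x. \<Sum>j\<in>J. g j x) = (\<Sum>j\<in>J. \<Lambda> (g j))" if "finite J" for J :: "nat set" and g
    using that by (induction J rule: finite_induct) (auto simp: zero add)
  have bound_r: "norm (\<Lambda> (\<lambda>x. f (of_real x))) \<le> 2 * M * \<tau> / (r - 1) + 4 * M / (r ^ s * (r - 1))"
    if r: "1 < r" "r < \<rho>" for r
  proof -
    obtain \<alpha> where \<alpha>: "\<And>j. norm (\<alpha> j) \<le> 2 * M / r ^ j"
      and approx: "\<And>x s. x \<in> {a..b} \<Longrightarrow>
        norm (f (of_real x) - (\<Sum>j\<le>s. \<alpha> j * ?P j x)) \<le> 2 * M / (r ^ s * (r - 1))"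
      using Anl_approximation[OF ab f r] by blast
    define R where "R = (\<lambda>x. f (of_real x) - (\<Sum>j\<le>s. \<alpha> j * ?P j x))"
    have "norm (\<Lambda> R) \<le> 2 * (2 * M / (r ^ s * (r - 1)))"
      unfolding R_def by (intro bound approx)
    have "\<Lambda> (\<lambda>x. f (of_real x)) = \<Lambda> (\<lambda>x. (\<Sum>j\<le>s. \<alpha> j * ?P j x) + R x)"
      by (simp add: R_def)
    also have "\<dots> = (\<Sum>j\<le>s. \<alpha> j * \<Lambda> (?P j)) + \<Lambda> R"
      by (simp only: add sum finite_atMost mult)
    also have "(\<Sum>j\<le>s. \<alpha> j * \<Lambda> (?P j)) = (\<Sum>j=1..s. \<alpha> j * \<Lambda> (?P j))"
      by (intro sum.mono_neutral_right) (auto simp: scaled_cheb_0 const not_le)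
    finally have split: "\<Lambda> (\<lambda>x. f (of_real x)) = (\<Sum>j=1..s. \<alpha> j * \<Lambda> (?P j)) + \<Lambda> R" .
    have "norm (\<Sum>j=1..s. \<alpha> j * \<Lambda> (?P j)) \<le> (\<Sum>j=1..s. 2 * M / r ^ j * \<tau>)"
    proof (intro sum_norm_le)
      fix j assume "j \<in> {1..s}"
      then have "norm (\<Lambda> (?P j)) \<le> \<tau>" using cheb_small by simp
      then show "norm (\<alpha> j * \<Lambda> (?P j)) \<le> 2 * M / r ^ j * \<tau>"
        unfolding norm_mult using \<alpha>[of j] \<open>0 < M\<close> r by (intro mult_mono) auto
    qed
    also have "\<dots> = 2 * M * \<tau> * (\<Sum>j=1..s. (1 / r) ^ j)"
      by (simp add: sum_distrib_left power_divide mult_ac)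
    also have "\<dots> \<le> 2 * M * \<tau> * (1 / (r - 1))"
    proof (intro mult_left_mono)
      have "(\<Sum>j=1..s. (1 / r) ^ j) = (1 - (1 / r) ^ s) / (r - 1)"
      proof (induction s)
        case (Suc s)
        have "(1 - x) / (r - 1) + 1 / r * x = (1 - 1 / r * x) / (r - 1)" for x
          using r by (simp add: field_simps)
        from this[of "(1 / r) ^ s"] show ?case using Suc by simp
      qed simp
      also have "\<dots> \<le> 1 / (r - 1)" using r by (intro divide_right_mono) auto
      finally show "(\<Sum>j=1..s. (1 / r) ^ j) \<le> 1 / (r - 1)" .
    qed (use \<open>0 < M\<close> \<open>0 \<le> \<tau>\<close> in simp)
    finally have "norm (\<Sum>j=1..s. \<alpha> j * \<Lambda> (?P j)) \<le> 2 * M * \<tau> / (r - 1)" by simp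
    then show ?thesis
      unfolding split using \<open>norm (\<Lambda> R) \<le> _\<close> by (intro norm_triangle_le) simp
  qed
  have "((\<lambda>r. 2 * M * \<tau> / (r - 1) + 4 * M / (r ^ s * (r - 1))) \<longlongrightarrow>
      2 * M * \<tau> / (\<rho> - 1) + 4 * M / (\<rho> ^ s * (\<rho> - 1))) (at_left \<rho>)"
    using \<open>1 < \<rho>\<close> by (intro tendsto_intros) auto
  moreover have "\<forall>\<^sub>F r in at_left \<rho>. norm (\<Lambda> (\<lambda>x. f (of_real x)))
      \<le> 2 * M * \<tau> / (r - 1) + 4 * M / (r ^ s * (r - 1))"
    using eventually_at_left_real[OF \<open>1 < \<rho>\<close>] by eventually_elim (use bound_r in auto)
  ultimately show ?thesis
    by (rule tendsto_lowerbound) simp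
qed

section \<open>The spectral theorem for Hermitian matrices\<close>

lemma cinner_eq_sum:
  assumes "v \<in> carrier_vec n"
  shows "u \<bullet>c v = (\<Sum>a<n. u $ a * cnj (v $ a :: complex))"
  using assms by (simp add: scalar_prod_def atLeast0LessThan)

lemma mult_mat_vec_nth:
  assumes "B \<in> carrier_mat n m" "w \<in> carrier_vec m" "a < n"
  shows "(B *\<^sub>v w) $ a = (\<Sum>b<m. B $$ (a, b) * (w $ b :: complex))"
  using assms by (simp add: scalar_prod_def atLeast0LessThan)

lemma cinner_commute:
  assumes "u \<in> carrier_vec n" "v \<in> carrier_vec n"
  shows "v \<bullet>c u = cnj (u \<bullet>c v :: complex)"
  unfolding cinner_eq_sum[OF assms(1)] cinner_eq_sum[OF assms(2)]
  by (simp add: mult.commute)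

lemma cinner_self:
  assumes "v \<in> carrier_vec n"
  shows "v \<bullet>c v = complex_of_real (\<Sum>a<n. (cmod (v $ a))\<^sup>2)"
  unfolding cinner_eq_sum[OF assms] by (simp flip: complex_norm_square)

lemma cinner_smult_left:
  assumes "u \<in> carrier_vec n" "v \<in> carrier_vec n"
  shows "(c \<cdot>\<^sub>v u) \<bullet>c v = c * (u \<bullet>c v :: complex)"
  using assms by (simp add: cinner_eq_sum[OF assms(2)] sum_distrib_left mult_ac)

lemma cinner_smult_right:
  assumes "u \<in> carrier_vec n" "v \<in> carrier_vec n"
  shows "u \<bullet>c (c \<cdot>\<^sub>v v) = cnj c * (u \<bullet>c v :: complex)"
proof -
  have "c \<cdot>\<^sub>v v \<in> carrier_vec n" using assms by simp
  from cinner_eq_sum[OF this] show ?thesis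
    using assms by (simp add: cinner_eq_sum[OF assms(2)] sum_distrib_left mult_ac)
qed

lemma hermitian_entry:
  assumes "hermitian A" "A \<in> carrier_mat n n" "a < n" "b < n"
  shows "A $$ (a, b) = cnj (A $$ (b, a))"
proof -
  have "A $$ (a, b) = mat_adjoint A $$ (a, b)" using assms(1) by (simp add: hermitian_def)
  also have "\<dots> = cnj (A $$ (b, a))"
    using assms(2-4) by (simp add: mat_adjoint_def mat_of_rows_def)
  finally show ?thesis .
qed

lemma hermitian_self_adjoint:
  assumes A: "hermitian A" "A \<in> carrier_mat n n" and "u \<in> carrier_vec n" "v \<in> carrier_vec n"
  shows "(A *\<^sub>v u) \<bullet>c v = u \<bullet>c (A *\<^sub>v v)"
proof -
  have Av: "A *\<^sub>v v \<in> carrier_vec n" using A assms by simp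
  have "(A *\<^sub>v u) \<bullet>c v = (\<Sum>a<n. \<Sum>b<n. A $$ (a, b) * u $ b * cnj (v $ a))"
    unfolding cinner_eq_sum[OF assms(4)]
    by (intro sum.cong) (auto simp: mult_mat_vec_nth[OF A(2) assms(3)] sum_distrib_right simp del: index_mult_mat_vec)
  also have "\<dots> = (\<Sum>b<n. \<Sum>a<n. A $$ (a, b) * u $ b * cnj (v $ a))" by (rule sum.swap)
  also have "\<dots> = (\<Sum>b<n. u $ b * cnj (\<Sum>a<n. A $$ (b, a) * v $ a))"
  proof (intro sum.cong refl)
    fix b assume b: "b \<in> {..<n}"
    have "(\<Sum>a<n. A $$ (a, b) * u $ b * cnj (v $ a)) = (\<Sum>a<n. u $ b * (cnj (A $$ (b, a)) * cnj (v $ a)))"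
    proof (intro sum.cong refl)
      fix a assume "a \<in> {..<n}"
      then have "A $$ (a, b) = cnj (A $$ (b, a))" using b by (intro hermitian_entry[OF A]) simp_all
      then show "A $$ (a, b) * u $ b * cnj (v $ a) = u $ b * (cnj (A $$ (b, a)) * cnj (v $ a))"
        by (simp only: mult_ac)
    qed
    then show "(\<Sum>a<n. A $$ (a, b) * u $ b * cnj (v $ a)) = u $ b * cnj (\<Sum>a<n. A $$ (b, a) * v $ a)"
      by (simp only: cnj_sum complex_cnj_mult sum_distrib_left)
  qed
  also have "\<dots> = u \<bullet>c (A *\<^sub>v v)"
    unfolding cinner_eq_sum[OF Av]
    by (intro sum.cong) (auto simp: mult_mat_vec_nth[OF A(2) assms(4)] simp del: index_mult_mat_vec)
  finally show ?thesis .
qed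

lemma mat_trace_mult_commute:
  assumes "A \<in> carrier_mat n m" "B \<in> carrier_mat m n"
  shows "mat_trace (A * B) = mat_trace (B * A)"
proof -
  have "mat_trace (A * B) = (\<Sum>i<n. \<Sum>j<m. A $$ (i, j) * B $$ (j, i))"
    using assms by (simp add: mat_trace_def scalar_prod_def atLeast0LessThan)
  also have "\<dots> = (\<Sum>j<m. \<Sum>i<n. B $$ (j, i) * A $$ (i, j))"
    by (subst sum.swap) (simp add: mult.commute)
  also have "\<dots> = mat_trace (B * A)"
    using assms by (simp add: mat_trace_def scalar_prod_def atLeast0LessThan)
  finally show ?thesis .
qed

text \<open>Schur triangularisation and invariance of the trace under similarity.\<close>

lemma mat_trace_eq_sum_eigenvalues:
  assumes B: "B \<in> carrier_mat n n" and es: "char_poly B = (\<Prod>e\<leftarrow>es. [:- e, 1:])"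
  shows "mat_trace B = sum_list es"
proof -
  obtain C P Q where schur: "schur_decomposition B es = (C, P, Q)"
    by (cases "schur_decomposition B es") auto
  have wit: "similar_mat_wit B C P Q" and diag: "diag_mat C = es"
    using schur_decomposition[OF B es schur] by auto
  note wit = similar_mat_witD2[OF B wit]
  have "mat_trace B = mat_trace (P * (C * Q))" using wit by (simp add: assoc_mult_mat[of P n n C n Q n])
  also have "\<dots> = mat_trace ((C * Q) * P)" using wit by (intro mat_trace_mult_commute[of _ n n]) auto
  also have "(C * Q) * P = C" using wit by (simp add: assoc_mult_mat[of C n n Q n P n])
  also have "mat_trace C = sum_list (diag_mat C)"
    by (simp add: mat_trace_def diag_mat_def sum_list_sum_nth atLeast0LessThan)
  finally show ?thesis using diag by simp
qed

definition orthonormal :: "nat \<Rightarrow> nat \<Rightarrow> (nat \<Rightarrow> complex Matrix.vec) \<Rightarrow> bool" where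
  "orthonormal n k u \<longleftrightarrow> (\<forall>i<k. u i \<in> carrier_vec n) \<and>
     (\<forall>i<k. \<forall>j<k. u i \<bullet>c u j = (if i = j then 1 else 0))"

lemma spectral_sum_carrier [simp]: "spectral_sum n g u \<in> carrier_mat n n"
  by (simp add: spectral_sum_def)

lemma mat_trace_rank_one_sum:
  assumes u: "orthonormal n k u"
  shows "(\<Sum>a<n. \<Sum>i<k. g i * (u i $ a) * cnj (u i $ a)) = (\<Sum>i<k. g i)"
proof -
  have "(\<Sum>a<n. \<Sum>i<k. g i * (u i $ a) * cnj (u i $ a)) = (\<Sum>i<k. \<Sum>a<n. g i * (u i $ a) * cnj (u i $ a))"
    by (rule sum.swap)
  also have "\<dots> = (\<Sum>i<k. g i * (u i \<bullet>c u i))"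
    using u by (intro sum.cong) (auto simp: orthonormal_def cinner_eq_sum[of _ n] sum_distrib_left mult_ac)
  also have "\<dots> = (\<Sum>i<k. g i)" using u by (intro sum.cong) (auto simp: orthonormal_def)
  finally show ?thesis .
qed

text \<open>Deflation: replacing the eigenvalues of the given \<open>u i\<close> by a common value \<open>s\<close> gives
  \<open>B = A + \<Sum>i<k. (s - \<lambda>\<^sub>i) u\<^sub>i u\<^sub>i\<^sup>*\<close>. If all eigenvalues of \<open>B\<close> were equal to \<open>s\<close>, its trace would be \<open>n s\<close>; one choice
  of \<open>s\<close> excludes this. An eigenvector of \<open>B\<close> for an eigenvalue other than \<open>s\<close> is orthogonal to every \<open>u i\<close>,
  because \<open>B\<close> acts on them as \<open>s\<close> from both sides, and on such vectors \<open>A\<close> and \<open>B\<close> agree.\<close>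

lemma hermitian_orthogonal_eigenvector:
  assumes A: "hermitian A" "A \<in> carrier_mat n n" and "k < n" and u: "orthonormal n k u"
    and eig: "\<And>i. i < k \<Longrightarrow> A *\<^sub>v u i = complex_of_real (lam i) \<cdot>\<^sub>v u i"
  obtains w \<mu> where "w \<in> carrier_vec n" "w \<noteq> 0\<^sub>v n" "A *\<^sub>v w = complex_of_real \<mu> \<cdot>\<^sub>v w"
    "\<And>i. i < k \<Longrightarrow> w \<bullet>c u i = 0"
proof -
  have uc: "u i \<in> carrier_vec n" if "i < k" for i using u that by (simp add: orthonormal_def)
  \<comment> \<open>The value that makes the trace of \<open>B\<close> equal to \<open>n s - (n - k)\<close>.\<close>
  define s where "s = (mat_trace A - (\<Sum>i<k. complex_of_real (lam i))) / of_nat (n - k) + 1"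
  define B where "B = Matrix.mat n n (\<lambda>(a, b). A $$ (a, b)
      + (\<Sum>i<k. (s - of_real (lam i)) * (u i $ a) * cnj (u i $ b)))"
  have B: "B \<in> carrier_mat n n" by (simp add: B_def)
  have "mat_trace B = mat_trace A + (\<Sum>i<k. s - of_real (lam i))"
    using mat_trace_rank_one_sum[OF u, of "\<lambda>i. s - of_real (lam i)"] A(2)
    by (simp add: mat_trace_def B_def sum.distrib)
  also have "\<dots> = (mat_trace A - (\<Sum>i<k. complex_of_real (lam i))) + of_nat k * s"
    by (simp add: sum_subtractf)
  also have "mat_trace A - (\<Sum>i<k. complex_of_real (lam i)) = of_nat (n - k) * (s - 1)"
    using \<open>k < n\<close> by (simp add: s_def)
  also have "\<dots> + of_nat k * s = of_nat n * s - of_nat (n - k)"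
    using \<open>k < n\<close> by (simp add: of_nat_diff algebra_simps)
  finally have trB: "mat_trace B \<noteq> of_nat n * s" using \<open>k < n\<close> by simp
  obtain es where es: "char_poly B = (\<Prod>e\<leftarrow>es. [:- e, 1:])" "length es = n"
    using char_poly_factorized[OF B] by blast
  have "\<exists>e\<in>set es. e \<noteq> s"
  proof (rule ccontr)
    assume "\<not> ?thesis"
    then have "es = replicate n s" using es(2) by (simp add: replicate_eqI)
    then have "sum_list es = of_nat n * s" by (simp add: sum_list_replicate)
    with trB mat_trace_eq_sum_eigenvalues[OF B es(1)] show False by simp
  qed
  then obtain e where e: "e \<in> set es" "e \<noteq> s" by auto
  have "poly (char_poly B) e = 0"
    unfolding es(1) using e(1) by (simp add: poly_prod_list prod_list_zero_iff image_iff)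
  then have "eigenvalue B e" using eigenvalue_root_char_poly[OF B] by simp
  then obtain w where w: "w \<in> carrier_vec n" "w \<noteq> 0\<^sub>v n" "B *\<^sub>v w = e \<cdot>\<^sub>v w"
    using B by (auto simp: eigenvalue_def eigenvector_def)
  have Bw: "(B *\<^sub>v w) $ a = (A *\<^sub>v w) $ a + (\<Sum>i<k. (s - of_real (lam i)) * (w \<bullet>c u i) * u i $ a)"
    if a: "a < n" for a
  proof -
    have "(B *\<^sub>v w) $ a = (\<Sum>b<n. A $$ (a, b) * w $ b)
      + (\<Sum>b<n. \<Sum>i<k. (s - of_real (lam i)) * (u i $ a) * cnj (u i $ b) * w $ b)"
      unfolding mult_mat_vec_nth[OF B w(1) a] using a
      by (simp add: B_def distrib_right sum.distrib sum_distrib_right)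
    also have "(\<Sum>b<n. \<Sum>i<k. (s - of_real (lam i)) * (u i $ a) * cnj (u i $ b) * w $ b)
      = (\<Sum>i<k. \<Sum>b<n. (s - of_real (lam i)) * (u i $ a) * cnj (u i $ b) * w $ b)" by (rule sum.swap)
    also have "\<dots> = (\<Sum>i<k. (s - of_real (lam i)) * (w \<bullet>c u i) * u i $ a)"
      by (intro sum.cong) (auto simp: cinner_eq_sum[OF uc] sum_distrib_left sum_distrib_right mult_ac)
    finally show ?thesis by (simp only: mult_mat_vec_nth[OF A(2) w(1) a])
  qed
  have orth: "w \<bullet>c u j = 0" if j: "j < k" for j
  proof -
    have Aw: "A *\<^sub>v w \<in> carrier_vec n" using A w by simp
    have "e * (w \<bullet>c u j) = (B *\<^sub>v w) \<bullet>c u j"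
      using w uc[OF j] by (simp add: cinner_smult_left[of _ n])
    also have "\<dots> = (\<Sum>a<n. (A *\<^sub>v w) $ a * cnj (u j $ a)
        + (\<Sum>i<k. (s - of_real (lam i)) * (w \<bullet>c u i) * (u i $ a * cnj (u j $ a))))"
      unfolding cinner_eq_sum[OF uc[OF j], of "B *\<^sub>v w"]
      by (intro sum.cong) (simp_all only: Bw lessThan_iff distrib_right sum_distrib_right mult.assoc)
    also have "\<dots> = (A *\<^sub>v w) \<bullet>c u j
        + (\<Sum>a<n. \<Sum>i<k. (s - of_real (lam i)) * (w \<bullet>c u i) * (u i $ a * cnj (u j $ a)))"
      unfolding cinner_eq_sum[OF uc[OF j], of "A *\<^sub>v w"] by (rule sum.distrib)
    also have "(\<Sum>a<n. \<Sum>i<k. (s - of_real (lam i)) * (w \<bullet>c u i) * (u i $ a * cnj (u j $ a)))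
        = (\<Sum>i<k. \<Sum>a<n. (s - of_real (lam i)) * (w \<bullet>c u i) * (u i $ a * cnj (u j $ a)))"
      by (rule sum.swap)
    also have "\<dots> = (\<Sum>i<k. (s - of_real (lam i)) * (w \<bullet>c u i) * (u i \<bullet>c u j))"
      unfolding cinner_eq_sum[OF uc[OF j]] by (simp only: sum_distrib_left)
    also have "\<dots> = (\<Sum>i<k. if i = j then (s - of_real (lam i)) * (w \<bullet>c u i) else 0)"
      using u j by (intro sum.cong) (auto simp: orthonormal_def)
    also have "\<dots> = (s - of_real (lam j)) * (w \<bullet>c u j)" using j by simp
    also have "(A *\<^sub>v w) \<bullet>c u j = of_real (lam j) * (w \<bullet>c u j)"
      using hermitian_self_adjoint[OF A w(1) uc[OF j]] eig[OF j] cinner_smult_right[OF w(1) uc[OF j]]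
      by simp
    finally have "(e - s) * (w \<bullet>c u j) = 0" by (simp add: algebra_simps)
    then show ?thesis using e(2) by simp
  qed
  have Aw: "A *\<^sub>v w = e \<cdot>\<^sub>v w"
  proof (rule eq_vecI)
    fix a assume "a < dim_vec (e \<cdot>\<^sub>v w)"
    then have a: "a < n" using w(1) by simp
    have "(A *\<^sub>v w) $ a = (B *\<^sub>v w) $ a" unfolding Bw[OF a] by (simp add: orth)
    then show "(A *\<^sub>v w) $ a = (e \<cdot>\<^sub>v w) $ a" using w(3) by simp
  qed (use A w in simp)
  have "w \<bullet>c w \<noteq> 0" using w(1,2) by (simp add: conjugate_square_eq_0_vec)
  moreover have "e * (w \<bullet>c w) = cnj e * (w \<bullet>c w)"
    using hermitian_self_adjoint[OF A w(1) w(1)] unfolding Aw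
    by (simp only: cinner_smult_left[OF w(1) w(1)] cinner_smult_right[OF w(1) w(1)])
  ultimately have "e = cnj e" by simp
  then have "e = complex_of_real (Re e)" by (simp add: complex_eq_iff)
  then show thesis using that[of w "Re e"] w Aw orth by simp
qed

lemma hermitian_orthonormal_eigenvectors:
  assumes A: "hermitian A" "A \<in> carrier_mat n n" and "k \<le> n"
  shows "\<exists>u lam. orthonormal n k u \<and> (\<forall>i<k. A *\<^sub>v u i = complex_of_real (lam i) \<cdot>\<^sub>v u i)"
  using \<open>k \<le> n\<close>
proof (induction k)
  case 0
  show ?case by (simp add: orthonormal_def)
next
  case (Suc k)
  then obtain u lam where u: "orthonormal n k u"
    and eig: "\<And>i. i < k \<Longrightarrow> A *\<^sub>v u i = complex_of_real (lam i) \<cdot>\<^sub>v u i" by auto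
  have "k < n" using Suc.prems by simp
  obtain w \<mu> where w: "w \<in> carrier_vec n" "w \<noteq> 0\<^sub>v n" "A *\<^sub>v w = complex_of_real \<mu> \<cdot>\<^sub>v w"
    and w_orth: "\<And>i. i < k \<Longrightarrow> w \<bullet>c u i = 0"
    using hermitian_orthogonal_eigenvector[OF A \<open>k < n\<close> u, of lam] eig by blast
  define q where "q = (\<Sum>a<n. (cmod (w $ a))\<^sup>2)"
  have ww: "w \<bullet>c w = complex_of_real q" using cinner_self[OF w(1)] by (simp add: q_def)
  have "w \<bullet>c w \<noteq> 0" using w(1,2) by (simp add: conjugate_square_eq_0_vec)
  then have "q \<noteq> 0" using ww by auto
  moreover have "0 \<le> q" by (simp add: q_def sum_nonneg)
  ultimately have "0 < q" by simp
  define c where "c = complex_of_real (1 / sqrt q)"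
  have c_real: "cnj c = c" by (simp add: c_def)
  have cc: "c * (c * complex_of_real q) = 1"
  proof -
    have "1 / sqrt q * (1 / sqrt q * q) = 1" using \<open>0 < q\<close> by (simp add: field_simps)
    then show ?thesis unfolding c_def by (metis of_real_1 of_real_mult)
  qed
  define x where "x = c \<cdot>\<^sub>v w"
  have x: "x \<in> carrier_vec n" using w by (simp add: x_def)
  have xx: "x \<bullet>c x = 1"
    unfolding x_def using w(1) cc
    by (simp add: cinner_smult_left[of _ n] cinner_smult_right[of _ n] c_real ww)
  have uc: "u i \<in> carrier_vec n" if "i < k" for i using u that by (simp add: orthonormal_def)
  have xu: "x \<bullet>c u i = 0" if "i < k" for i
    unfolding x_def using cinner_smult_left[OF w(1) uc[OF that]] w_orth[OF that] by simp
  have ux: "u i \<bullet>c x = 0" if "i < k" for i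
    using cinner_commute[OF x uc[OF that]] xu[OF that] by simp
  have Ax: "A *\<^sub>v x = complex_of_real \<mu> \<cdot>\<^sub>v x"
    unfolding x_def using A w by (simp add: mult_mat_vec[of A n n] smult_smult_assoc mult.commute)
  show ?case
  proof (intro exI conjI allI impI)
    show "orthonormal n (Suc k) (u(k := x))"
      using u x xx xu ux by (auto simp: orthonormal_def less_Suc_eq)
    fix i assume "i < Suc k"
    then show "A *\<^sub>v (u(k := x)) i = complex_of_real ((lam(k := \<mu>)) i) \<cdot>\<^sub>v (u(k := x)) i"
      using eig Ax by (auto simp: less_Suc_eq)
  qed
qed

text \<open>For a square matrix, \<open>U\<^sup>* U = 1\<close> implies \<open>U U\<^sup>* = 1\<close>.\<close>

lemma orthonormal_complete:
  assumes u: "orthonormal n n u" and "a < n" "b < n"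
  shows "(\<Sum>i<n. u i $ a * cnj (u i $ b)) = (if a = b then 1 else 0)"
proof -
  define U where "U = Matrix.mat n n (\<lambda>(a, i). u i $ a)"
  define V where "V = Matrix.mat n n (\<lambda>(i, a). cnj (u i $ a))"
  have "V * U = 1\<^sub>m n"
  proof (rule eq_matI)
    fix i j assume "i < dim_row (1\<^sub>m n :: complex mat)" "j < dim_col (1\<^sub>m n :: complex mat)"
    then have ij: "i < n" "j < n" by auto
    then have "u i \<in> carrier_vec n" using u by (simp add: orthonormal_def)
    have "(V * U) $$ (i, j) = (\<Sum>a<n. cnj (u i $ a) * u j $ a)"
      using ij by (simp add: U_def V_def scalar_prod_def atLeast0LessThan)
    also have "\<dots> = u j \<bullet>c u i"
      unfolding cinner_eq_sum[OF \<open>u i \<in> carrier_vec n\<close>] by (simp add: mult.commute)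
    finally show "(V * U) $$ (i, j) = 1\<^sub>m n $$ (i, j)"
      using u ij by (auto simp: orthonormal_def)
  qed (simp_all add: U_def V_def)
  then have "U * V = 1\<^sub>m n"
    by (rule mat_mult_left_right_inverse[rotated 2]) (simp_all add: U_def V_def)
  moreover have "(U * V) $$ (a, b) = (\<Sum>i<n. u i $ a * cnj (u i $ b))"
    using assms by (simp add: U_def V_def scalar_prod_def atLeast0LessThan)
  ultimately show ?thesis using assms by simp
qed

lemma eigendecomposition_exists:
  assumes A: "hermitian A" "A \<in> carrier_mat n n"
  shows "\<exists>lam u. eigendecomposition A lam u"
proof -
  obtain u lam where u: "orthonormal n n u"
    and eig: "\<And>i. i < n \<Longrightarrow> A *\<^sub>v u i = complex_of_real (lam i) \<cdot>\<^sub>v u i"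
    using hermitian_orthonormal_eigenvectors[OF A order.refl] by auto
  have uc: "u i \<in> carrier_vec n" if "i < n" for i using u that by (simp add: orthonormal_def)
  have "A = spectral_sum n (\<lambda>i. complex_of_real (lam i)) u"
  proof (rule eq_matI)
    fix a b assume "a < dim_row (spectral_sum n (\<lambda>i. complex_of_real (lam i)) u)"
      "b < dim_col (spectral_sum n (\<lambda>i. complex_of_real (lam i)) u)"
    then have ab: "a < n" "b < n" by (auto simp: spectral_sum_def)
    have "A $$ (a, b) = (\<Sum>c<n. A $$ (a, c) * (\<Sum>i<n. u i $ c * cnj (u i $ b)))"
      using ab by (simp add: orthonormal_complete[OF u] if_distrib cong: if_cong)
    also have "\<dots> = (\<Sum>c<n. \<Sum>i<n. A $$ (a, c) * u i $ c * cnj (u i $ b))"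
      by (simp only: sum_distrib_left mult.assoc)
    also have "\<dots> = (\<Sum>i<n. \<Sum>c<n. A $$ (a, c) * u i $ c * cnj (u i $ b))" by (rule sum.swap)
    also have "\<dots> = (\<Sum>i<n. (A *\<^sub>v u i) $ a * cnj (u i $ b))"
      by (intro sum.cong) (simp_all only: mult_mat_vec_nth[OF A(2) uc ab(1)] lessThan_iff sum_distrib_right)
    also have "\<dots> = (\<Sum>i<n. complex_of_real (lam i) * u i $ a * cnj (u i $ b))"
    proof (intro sum.cong refl)
      fix i assume "i \<in> {..<n}"
      then have "(A *\<^sub>v u i) $ a = complex_of_real (lam i) * u i $ a"
        using eig[of i] uc[of i] ab by simp
      then show "(A *\<^sub>v u i) $ a * cnj (u i $ b) = complex_of_real (lam i) * u i $ a * cnj (u i $ b)"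
        by (simp only:)
    qed
    finally show "A $$ (a, b) = spectral_sum n (\<lambda>i. complex_of_real (lam i)) u $$ (a, b)"
      using ab by (simp add: spectral_sum_def)
  qed (use A in \<open>auto simp: spectral_sum_def\<close>)
  moreover have "dim_row A = n" using A by simp
  ultimately have "eigendecomposition A lam u"
    using u by (simp only: eigendecomposition_def orthonormal_def Let_def simp_thms)
  then show ?thesis by blast
qed

lemma eigen_system:
  assumes A: "hermitian A" "A \<in> carrier_mat n n"
  shows "orthonormal n n (eigvec A)"
    and "A = spectral_sum n (\<lambda>i. complex_of_real (eigval A i)) (eigvec A)"
proof -
  have "\<exists>p. case p of (lam, u) \<Rightarrow> eigendecomposition A lam u"
    using eigendecomposition_exists[OF A] by auto
  then have "case eigen_system A of (lam, u) \<Rightarrow> eigendecomposition A lam u"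
    unfolding eigen_system_def by (rule someI_ex)
  then have "eigendecomposition A (eigval A) (eigvec A)" by (simp add: case_prod_beta)
  then show "orthonormal n n (eigvec A)"
    and "A = spectral_sum n (\<lambda>i. complex_of_real (eigval A i)) (eigvec A)"
    using A(2) by (auto simp: eigendecomposition_def orthonormal_def Let_def)
qed

lemma orthonormal_expansion:
  assumes u: "orthonormal n n u" and v: "v \<in> carrier_vec n" and "a < n"
  shows "v $ a = (\<Sum>i<n. (v \<bullet>c u i) * u i $ a)"
proof -
  have "v $ a = (\<Sum>b<n. v $ b * (\<Sum>i<n. u i $ a * cnj (u i $ b)))"
    using \<open>a < n\<close> by (simp add: orthonormal_complete[OF u] if_distrib cong: if_cong)
  also have "\<dots> = (\<Sum>b<n. \<Sum>i<n. v $ b * cnj (u i $ b) * u i $ a)"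
    by (simp only: sum_distrib_left mult_ac)
  also have "\<dots> = (\<Sum>i<n. \<Sum>b<n. v $ b * cnj (u i $ b) * u i $ a)" by (rule sum.swap)
  also have "\<dots> = (\<Sum>i<n. (v \<bullet>c u i) * u i $ a)"
    using u by (intro sum.cong) (auto simp: orthonormal_def cinner_eq_sum[of _ n] sum_distrib_right)
  finally show ?thesis .
qed

lemma spectral_sum_mult_vec:
  assumes u: "orthonormal n n u" and v: "v \<in> carrier_vec n" and "a < n"
  shows "(spectral_sum n g u *\<^sub>v v) $ a = (\<Sum>i<n. g i * (v \<bullet>c u i) * u i $ a)"
proof -
  have "(spectral_sum n g u *\<^sub>v v) $ a = (\<Sum>b<n. \<Sum>i<n. g i * (v $ b * cnj (u i $ b)) * u i $ a)"
    unfolding mult_mat_vec_nth[OF spectral_sum_carrier v \<open>a < n\<close>] using \<open>a < n\<close>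
    by (simp add: spectral_sum_def sum_distrib_left sum_distrib_right mult_ac)
  also have "\<dots> = (\<Sum>i<n. \<Sum>b<n. g i * (v $ b * cnj (u i $ b)) * u i $ a)" by (rule sum.swap)
  also have "\<dots> = (\<Sum>i<n. g i * (v \<bullet>c u i) * u i $ a)"
    using u by (intro sum.cong) (auto simp: orthonormal_def cinner_eq_sum[of _ n] sum_distrib_right sum_distrib_left)
  finally show ?thesis .
qed

lemma cinner_sum_orthonormal:
  assumes u: "orthonormal n k u" and v: "v \<in> carrier_vec n"
    and x: "\<And>a. a < n \<Longrightarrow> x $ a = (\<Sum>i<k. c i * u i $ a)"
  shows "x \<bullet>c v = (\<Sum>i<k. c i * cnj (v \<bullet>c u i))"
proof -
  have "x \<bullet>c v = (\<Sum>a<n. \<Sum>i<k. c i * (u i $ a * cnj (v $ a)))"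
    unfolding cinner_eq_sum[OF v]
    by (intro sum.cong) (simp_all only: x lessThan_iff sum_distrib_right mult.assoc)
  also have "\<dots> = (\<Sum>i<k. \<Sum>a<n. c i * (u i $ a * cnj (v $ a)))" by (rule sum.swap)
  also have "\<dots> = (\<Sum>i<k. c i * cnj (v \<bullet>c u i))"
  proof (intro sum.cong refl)
    fix i assume "i \<in> {..<k}"
    then have "u i \<in> carrier_vec n" using u by (simp add: orthonormal_def)
    then have "cnj (v \<bullet>c u i) = u i \<bullet>c v" using cinner_commute[OF v, of "u i"] by simp
    then show "(\<Sum>a<n. c i * (u i $ a * cnj (v $ a))) = c i * cnj (v \<bullet>c u i)"
      by (simp only: cinner_eq_sum[OF v] sum_distrib_left)
  qed
  finally show ?thesis .
qed

lemma spectral_sum_mult_vec_cinner: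
  assumes u: "orthonormal n n u" and v: "v \<in> carrier_vec n" and j: "j < n"
  shows "(spectral_sum n g u *\<^sub>v v) \<bullet>c u j = g j * (v \<bullet>c u j)"
proof -
  have "u j \<in> carrier_vec n" using u j by (simp add: orthonormal_def)
  then have "(spectral_sum n g u *\<^sub>v v) \<bullet>c u j = (\<Sum>i<n. g i * (v \<bullet>c u i) * cnj (u j \<bullet>c u i))"
    by (rule cinner_sum_orthonormal[OF u _ spectral_sum_mult_vec[OF u v]])
  also have "\<dots> = (\<Sum>i<n. if i = j then g i * (v \<bullet>c u i) else 0)"
    using u j by (intro sum.cong) (auto simp: orthonormal_def)
  finally show ?thesis using j by simp
qed

lemma parseval:
  assumes u: "orthonormal n n u" and v: "v \<in> carrier_vec n"
  shows "(\<Sum>i<n. (cmod (v \<bullet>c u i))\<^sup>2) = (\<Sum>a<n. (cmod (v $ a))\<^sup>2)"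
proof -
  have "complex_of_real (\<Sum>a<n. (cmod (v $ a))\<^sup>2) = v \<bullet>c v" by (rule cinner_self[OF v, symmetric])
  also have "\<dots> = (\<Sum>i<n. (v \<bullet>c u i) * cnj (v \<bullet>c u i))"
    by (rule cinner_sum_orthonormal[OF u v orthonormal_expansion[OF u v]])
  also have "\<dots> = complex_of_real (\<Sum>i<n. (cmod (v \<bullet>c u i))\<^sup>2)"
    by (simp flip: complex_norm_square)
  finally show ?thesis by (simp only: of_real_eq_iff)
qed

lemma vec_norm2_eq: "v \<in> carrier_vec n \<Longrightarrow> vec_norm2 v = sqrt (\<Sum>a<n. (cmod (v $ a))\<^sup>2)"
  by (auto simp: vec_norm2_def)

lemma mat_trace_spectral_sum:
  assumes u: "orthonormal n n u"
  shows "mat_trace (spectral_sum n g u) = (\<Sum>i<n. g i)"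
  using mat_trace_rank_one_sum[OF u, of g] by (simp add: mat_trace_def spectral_sum_def)

lemma quad_form_spectral_sum:
  assumes u: "orthonormal n n u" and v: "v \<in> carrier_vec n"
  shows "quad_form (spectral_sum n g u) v = (\<Sum>i<n. g i * complex_of_real ((cmod (u i \<bullet>c v))\<^sup>2))"
proof -
  have "quad_form (spectral_sum n g u) v = (\<Sum>i<n. g i * (v \<bullet>c u i) * cnj (v \<bullet>c u i))"
    unfolding quad_form_def by (rule cinner_sum_orthonormal[OF u v spectral_sum_mult_vec[OF u v]])
  also have "\<dots> = (\<Sum>i<n. g i * complex_of_real ((cmod (u i \<bullet>c v))\<^sup>2))"
  proof (intro sum.cong refl)
    fix i assume "i \<in> {..<n}"
    then have "u i \<in> carrier_vec n" using u by (simp add: orthonormal_def)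
    then have "cmod (u i \<bullet>c v) = cmod (v \<bullet>c u i)" using cinner_commute[OF v, of "u i"] by simp
    then show "g i * (v \<bullet>c u i) * cnj (v \<bullet>c u i) = g i * complex_of_real ((cmod (u i \<bullet>c v))\<^sup>2)"
      by (simp add: mult.assoc flip: complex_norm_square)
  qed
  finally show ?thesis .
qed

lemma spectral_norm_spectral_sum:
  assumes u: "orthonormal n n u" and g: "\<And>i. i < n \<Longrightarrow> cmod (g i) \<le> 1" and j: "j < n" "cmod (g j) = 1"
  shows "spectral_norm (spectral_sum n g u) = 1"
proof -
  let ?B = "spectral_sum n g u" and ?S = "{x \<in> carrier_vec n. vec_norm2 x = 1}"
  have dim: "dim_col ?B = n" by (simp add: spectral_sum_def)
  have norm_Bv: "vec_norm2 (?B *\<^sub>v v) = sqrt (\<Sum>i<n. (cmod (g i))\<^sup>2 * (cmod (v \<bullet>c u i))\<^sup>2)"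
    if v: "v \<in> carrier_vec n" for v
  proof -
    have Bv: "?B *\<^sub>v v \<in> carrier_vec n" using v by (rule mult_mat_vec_carrier[OF spectral_sum_carrier])
    show ?thesis
      unfolding vec_norm2_eq[OF Bv] parseval[OF u Bv, symmetric]
      by (intro arg_cong[where f = sqrt] sum.cong)
        (simp_all add: spectral_sum_mult_vec_cinner[OF u v] norm_mult power_mult_distrib)
  qed
  have le: "vec_norm2 (?B *\<^sub>v v) \<le> 1" if "v \<in> ?S" for v
  proof -
    have v: "v \<in> carrier_vec n" "vec_norm2 v = 1" using that by auto
    have "(\<Sum>i<n. (cmod (g i))\<^sup>2 * (cmod (v \<bullet>c u i))\<^sup>2) \<le> (\<Sum>i<n. 1 * (cmod (v \<bullet>c u i))\<^sup>2)"
      using g by (intro sum_mono mult_right_mono) (auto intro: power_le_one)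
    also have "\<dots> = 1"
      using v parseval[OF u v(1)] vec_norm2_eq[OF v(1)] by simp
    finally show ?thesis unfolding norm_Bv[OF v(1)] by simp
  qed
  have uj: "u j \<in> carrier_vec n" using u j by (simp add: orthonormal_def)
  have "complex_of_real (\<Sum>a<n. (cmod (u j $ a))\<^sup>2) = 1"
    using cinner_self[OF uj] u j by (simp add: orthonormal_def)
  then have "(\<Sum>a<n. (cmod (u j $ a))\<^sup>2) = 1" by (simp only: of_real_eq_1_iff)
  then have "u j \<in> ?S" using uj vec_norm2_eq[OF uj] by simp
  have "vec_norm2 (?B *\<^sub>v u j) = sqrt (\<Sum>i<n. if i = j then 1 else 0)"
    unfolding norm_Bv[OF uj] using u j by (intro arg_cong[where f = sqrt] sum.cong) (auto simp: orthonormal_def)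
  also have "\<dots> = 1" using j by simp
  finally have attained: "vec_norm2 (?B *\<^sub>v u j) = 1" .
  show ?thesis
    unfolding spectral_norm_def dim
  proof (rule antisym)
    show "(SUP x\<in>?S. vec_norm2 (?B *\<^sub>v x)) \<le> 1"
      using \<open>u j \<in> ?S\<close> le by (intro cSUP_least) auto
    have "bdd_above ((\<lambda>x. vec_norm2 (?B *\<^sub>v x)) ` ?S)" using le by (intro bdd_aboveI2[of _ _ 1]) auto
    then show "1 \<le> (SUP x\<in>?S. vec_norm2 (?B *\<^sub>v x))"
      using cSUP_upper[OF \<open>u j \<in> ?S\<close>, of "\<lambda>x. vec_norm2 (?B *\<^sub>v x)"] attained by simp
  qed
qed

text \<open>This identifies the extreme eigenvalues, which are defined without reference to an eigenbasis, with
  extreme values of the chosen eigenvalue family.\<close>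

lemma real_eigenvalues_hermitian:
  assumes A: "hermitian A" "A \<in> carrier_mat n n"
  shows "{x. eigenvalue A (complex_of_real x)} = eigval A ` {..<n}"
proof (intro equalityI subsetI)
  note u = eigen_system(1)[OF A]
  define B where "B = spectral_sum n (\<lambda>i. complex_of_real (eigval A i)) (eigvec A)"
  have AB: "A = B" unfolding B_def by (rule eigen_system(2)[OF A])
  {
    fix x assume "x \<in> eigval A ` {..<n}"
    then obtain i where i: "i < n" "x = eigval A i" by auto
    have ui: "eigvec A i \<in> carrier_vec n" "eigvec A i \<bullet>c eigvec A i = 1"
      using u i by (auto simp: orthonormal_def)
    have "A *\<^sub>v eigvec A i = complex_of_real x \<cdot>\<^sub>v eigvec A i"
    proof (rule eq_vecI)
      fix a assume "a < dim_vec (complex_of_real x \<cdot>\<^sub>v eigvec A i)"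
      then have a: "a < n" using ui by simp
      have "(B *\<^sub>v eigvec A i) $ a
        = (\<Sum>j<n. complex_of_real (eigval A j) * (eigvec A i \<bullet>c eigvec A j) * eigvec A j $ a)"
        unfolding B_def by (rule spectral_sum_mult_vec[OF u ui(1) a])
      also have "\<dots> = (\<Sum>j<n. if j = i then complex_of_real (eigval A i) * eigvec A i $ a else 0)"
        using u i by (intro sum.cong) (auto simp: orthonormal_def)
      also have "\<dots> = complex_of_real x * eigvec A i $ a" using i by simp
      finally show "(A *\<^sub>v eigvec A i) $ a = (complex_of_real x \<cdot>\<^sub>v eigvec A i) $ a"
        using AB a ui by simp
    qed (use A ui in simp)
    moreover have "eigvec A i \<noteq> 0\<^sub>v n" using ui by auto
    ultimately show "x \<in> {x. eigenvalue A (complex_of_real x)}"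
      using A ui by (auto simp: eigenvalue_def eigenvector_def)
  }
  fix x assume "x \<in> {x. eigenvalue A (complex_of_real x)}"
  then obtain v where v: "v \<in> carrier_vec n" "v \<noteq> 0\<^sub>v n" "A *\<^sub>v v = complex_of_real x \<cdot>\<^sub>v v"
    using A by (auto simp: eigenvalue_def eigenvector_def)
  have "\<exists>j<n. v \<bullet>c eigvec A j \<noteq> 0"
  proof (rule ccontr)
    assume "\<not> ?thesis"
    then have "(\<Sum>a<n. (cmod (v $ a))\<^sup>2) = 0" using parseval[OF u v(1)] by simp
    then have "v \<bullet>c v = 0" using cinner_self[OF v(1)] by simp
    then show False using v by (simp add: conjugate_square_eq_0_vec)
  qed
  then obtain j where j: "j < n" "v \<bullet>c eigvec A j \<noteq> 0" by auto
  have uj: "eigvec A j \<in> carrier_vec n" using u j by (simp add: orthonormal_def)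
  have "(B *\<^sub>v v) \<bullet>c eigvec A j = complex_of_real (eigval A j) * (v \<bullet>c eigvec A j)"
    unfolding B_def by (rule spectral_sum_mult_vec_cinner[OF u v(1) j(1)])
  moreover have "(A *\<^sub>v v) \<bullet>c eigvec A j = complex_of_real x * (v \<bullet>c eigvec A j)"
    unfolding v(3) by (rule cinner_smult_left[OF v(1) uj])
  ultimately have "complex_of_real x = complex_of_real (eigval A j)" using AB j(2) by simp
  then have "x = eigval A j" by (simp only: of_real_eq_iff)
  then show "x \<in> eigval A ` {..<n}" using j by auto
qed

section \<open>Error of the averaged quadrature for given samples\<close>

text \<open>Collects the weights of coinciding eigenvalues, as needed to write the spectral measure with one
  atom per value.\<close>

lemma sum_over_distinct_values:
  fixes n :: nat
  shows "(\<Sum>t\<in>x ` {..<n}. (\<Sum>i | i < n \<and> x i = t. c i) * h t) = (\<Sum>i<n. c i * (h (x i) :: real))"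
proof -
  have "(\<Sum>i<n. c i * h (x i)) = (\<Sum>t\<in>x ` {..<n}. \<Sum>i | i \<in> {..<n} \<and> x i = t. c i * h (x i))"
    by (rule sum.image_gen) simp
  also have "\<dots> = (\<Sum>t\<in>x ` {..<n}. (\<Sum>i | i < n \<and> x i = t. c i) * h t)"
    by (intro sum.cong refl) (simp add: sum_distrib_right)
  finally show ?thesis by simp
qed

lemma gauss_quad_weighted_cesm:
  assumes A: "hermitian A" "A \<in> carrier_mat n n" and "odd s" and v: "v \<in> carrier_vec n"
    and eig: "eigval A ` {..<n} \<subseteq> {a..b}"
  obtains Z w where "finite Z" "Z \<subseteq> {a..b}" "\<And>t. t \<in> Z \<Longrightarrow> 0 \<le> w t"
    "gauss_quad (weighted_cesm A v) s = step_df Z w"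
    "\<And>q. degree q \<le> s \<Longrightarrow> complex_of_real (\<Sum>t\<in>Z. w t * poly q t)
       = quad_form (matrix_fun (\<lambda>z. of_real (poly q (Re z))) A) v"
proof -
  define c where "c = (\<lambda>i. (cmod (eigvec A i \<bullet>c v))\<^sup>2)"
  define W where "W = (\<lambda>t. \<Sum>i | i < n \<and> eigval A i = t. c i)"
  have "weighted_cesm A v y = step_df (eigval A ` {..<n}) W y" for y
    using A(2) sum_over_distinct_values
      [where n = n and x = "eigval A" and c = c and h = "\<lambda>t. indicator {t..} y"]
    by (simp only: weighted_cesm_def step_df_def W_def c_def carrier_matD)
  then have "weighted_cesm A v = step_df (eigval A ` {..<n}) W" by (rule ext)
  moreover have "0 \<le> W t" for t by (simp add: W_def c_def sum_nonneg)
  ultimately have "\<exists>Z w. finite Z \<and> Z \<subseteq> {a..b} \<and> (\<forall>t\<in>Z. 0 \<le> w t) \<and>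
      gauss_quad (weighted_cesm A v) s = step_df Z w \<and>
      (\<forall>q. degree q \<le> s \<longrightarrow> (\<Sum>t\<in>Z. w t * poly q t) = (\<Sum>t\<in>eigval A ` {..<n}. W t * poly q t))"
    using gauss_quad_step_df[OF _ _ eig \<open>odd s\<close>, of W] by simp
  then obtain Z w where Zw: "finite Z" "Z \<subseteq> {a..b}" "\<And>t. t \<in> Z \<Longrightarrow> 0 \<le> w t"
    "gauss_quad (weighted_cesm A v) s = step_df Z w"
    and exact: "\<And>q. degree q \<le> s \<Longrightarrow>
      (\<Sum>t\<in>Z. w t * poly q t) = (\<Sum>t\<in>eigval A ` {..<n}. W t * poly q t)"
    by blast
  have quad: "quad_form (matrix_fun (\<lambda>z. of_real (poly q (Re z))) A) v = complex_of_real (\<Sum>i<n. c i * poly q (eigval A i))" for q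
  proof -
    have "dim_row A = n" using A by simp
    show ?thesis unfolding matrix_fun_def \<open>dim_row A = n\<close> quad_form_spectral_sum[OF eigen_system(1)[OF A] v]
      by (simp add: c_def mult.commute)
  qed
  show thesis
    by (rule that[OF Zw]) (simp_all only: quad exact W_def sum_over_distinct_values)
qed

lemma norm_convex_combination_le:
  fixes g :: "'a \<Rightarrow> complex"
  assumes "finite I" "\<And>i. i \<in> I \<Longrightarrow> 0 \<le> c i" "(\<Sum>i\<in>I. c i) = 1" "\<And>i. i \<in> I \<Longrightarrow> norm (g i) \<le> B"
  shows "norm (\<Sum>i\<in>I. complex_of_real (c i) * g i) \<le> B"
proof -
  have "norm (\<Sum>i\<in>I. complex_of_real (c i) * g i) \<le> (\<Sum>i\<in>I. c i * B)"
    using assms by (intro sum_norm_le) (simp add: norm_mult mult_left_mono)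
  also have "\<dots> = B" using assms(3) by (simp flip: sum_distrib_right)
  finally show ?thesis .
qed

definition cheb_matrix :: "complex mat \<Rightarrow> nat \<Rightarrow> complex mat" where
  "cheb_matrix A j = matrix_fun
     (\<lambda>z. of_real (poly (scaled_cheb (min_eigenvalue A) (max_eigenvalue A) j) (Re z))) A"

lemma
  assumes A: "hermitian A" "A \<in> carrier_mat n n" and "0 < n"
  shows eigval_in_range: "eigval A ` {..<n} \<subseteq> {min_eigenvalue A..max_eigenvalue A}"
    and max_eigenvalue_attained: "\<exists>i<n. eigval A i = max_eigenvalue A"
proof -
  have fin: "finite (eigval A ` {..<n})" "eigval A ` {..<n} \<noteq> {}" using \<open>0 < n\<close> by auto
  show "eigval A ` {..<n} \<subseteq> {min_eigenvalue A..max_eigenvalue A}"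
    unfolding min_eigenvalue_def max_eigenvalue_def real_eigenvalues_hermitian[OF A]
    using fin by (auto intro: Min_le Max_ge)
  have "max_eigenvalue A \<in> eigval A ` {..<n}"
    unfolding max_eigenvalue_def real_eigenvalues_hermitian[OF A] using fin by (rule Max_in)
  then show "\<exists>i<n. eigval A i = max_eigenvalue A" by auto
qed

text \<open>The largest eigenvalue is mapped to \<open>T\<^sub>j(1) = 1\<close>, so the norm is not only at most \<open>1\<close>. In particular
  \<open>T\<^sub>j(A) \<noteq> 0\<close>, which keeps the exponent in the concentration inequality from degenerating to a division
  by zero.\<close>

lemma spectral_norm_cheb_matrix:
  assumes A: "hermitian A" "A \<in> carrier_mat n n" and "0 < n" and lt: "min_eigenvalue A < max_eigenvalue A"
  shows "spectral_norm (cheb_matrix A j) = 1"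
proof -
  have "dim_row A = n" using A by simp
  obtain i where i: "i < n" "eigval A i = max_eigenvalue A"
    using max_eigenvalue_attained[OF A \<open>0 < n\<close>] by auto
  show ?thesis
    unfolding cheb_matrix_def matrix_fun_def \<open>dim_row A = n\<close>
  proof (rule spectral_norm_spectral_sum[OF eigen_system(1)[OF A] _ i(1)])
    fix l assume "l < n"
    then have "eigval A l \<in> {min_eigenvalue A..max_eigenvalue A}"
      using eigval_in_range[OF A \<open>0 < n\<close>] by blast
    from abs_scaled_cheb_le_1[OF lt this]
    show "cmod (complex_of_real (poly (scaled_cheb (min_eigenvalue A) (max_eigenvalue A) j)
        (Re (complex_of_real (eigval A l))))) \<le> 1" by simp
  qed (simp add: i poly_scaled_cheb_right_end[OF lt])
qed

text \<open>The deterministic part of the argument: for fixed unit vectors, control of the \<open>s\<close> deviations for the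
  matrices \<open>T\<^sub>j(A)\<close> controls the error for every \<open>f\<close>. The difference of the two averages is the functional
  \<open>\<Lambda>\<close> to which \<open>Anl_functional_bound\<close> is applied.\<close>

theorem quadrature_deviation_bound:
  assumes A: "hermitian A" "A \<in> carrier_mat n n" and n: "0 < n"
    and lt: "min_eigenvalue A < max_eigenvalue A" and s: "odd s" and m: "0 < (m::nat)"
    and v: "\<And>l. l \<in> {1..m} \<Longrightarrow> v l \<in> carrier_vec n" "\<And>l. l \<in> {1..m} \<Longrightarrow> v l \<bullet>c v l = 1"
    and dev: "\<And>j. 1 \<le> j \<Longrightarrow> j \<le> s \<Longrightarrow> norm (mat_trace (cheb_matrix A j) / of_nat n
        - (\<Sum>l=1..m. quad_form (cheb_matrix A j) (v l)) / of_nat m) \<le> \<tau>"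
    and par: "0 < M" "1 < \<rho>" "0 \<le> \<tau>" and f: "f \<in> Anl M \<rho> (min_eigenvalue A) (max_eigenvalue A)"
  shows "norm (mat_trace (matrix_fun f A) / of_nat n
      - (\<Sum>l=1..m. df_integral (bernstein_ellipse \<rho> (min_eigenvalue A) (max_eigenvalue A))
            (gauss_quad (weighted_cesm A (v l)) s) f) / of_nat m)
    \<le> 2 * M * \<tau> / (\<rho> - 1) + 4 * M / (\<rho> ^ s * (\<rho> - 1))"
proof -
  define a b where "a = min_eigenvalue A" and "b = max_eigenvalue A"
  have ab: "a < b" using lt by (simp add: a_def b_def)
  let ?E = "bernstein_ellipse \<rho> a b" and ?x = "eigval A"
  have dim: "dim_row A = n" using A by simp
  have eig: "?x ` {..<n} \<subseteq> {a..b}" using eigval_in_range[OF A n] by (simp add: a_def b_def)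
  define quad where "quad = (\<lambda>l Z w. finite Z \<and> Z \<subseteq> {a..b} \<and> (\<forall>t\<in>Z. 0 \<le> w t) \<and>
      gauss_quad (weighted_cesm A (v l)) s = step_df Z w \<and>
      (\<forall>q. degree q \<le> s \<longrightarrow> complex_of_real (\<Sum>t\<in>Z. w t * poly q t)
         = quad_form (matrix_fun (\<lambda>z. of_real (poly q (Re z))) A) (v l)))"
  \<comment> \<open>The rule and its exactness for each sample; the nodes depend on \<open>l\<close>.\<close>
  have "\<forall>l\<in>{1..m}. \<exists>Z w. quad l Z w"
  proof
    fix l assume "l \<in> {1..m}"
    from gauss_quad_weighted_cesm[OF A s v(1)[OF this] eig]
    show "\<exists>Z w. quad l Z w" unfolding quad_def by metis
  qed
  then obtain Z w where Zw: "\<forall>l\<in>{1..m}. quad l (Z l) (w l)"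
    unfolding bchoice_iff by (elim exE) (rule that)
  have Z: "finite (Z l)" "Z l \<subseteq> {a..b}" and w: "\<And>t. t \<in> Z l \<Longrightarrow> 0 \<le> w l t"
    and gq: "gauss_quad (weighted_cesm A (v l)) s = step_df (Z l) (w l)"
    and exact: "\<And>q. degree q \<le> s \<Longrightarrow> complex_of_real (\<Sum>t\<in>Z l. w l t * poly q t)
         = quad_form (matrix_fun (\<lambda>z. of_real (poly q (Re z))) A) (v l)"
    if "l \<in> {1..m}" for l
    using bspec[OF Zw that] unfolding quad_def by blast+
  have mass: "(\<Sum>t\<in>Z l. w l t) = 1" if l: "l \<in> {1..m}" for l
  proof -
    have "complex_of_real (\<Sum>t\<in>Z l. w l t) = quad_form (matrix_fun (\<lambda>z. 1) A) (v l)"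
      using exact[OF l, of 1] by simp
    also have "\<dots> = complex_of_real (\<Sum>i<n. (cmod (eigvec A i \<bullet>c v l))\<^sup>2)"
      unfolding matrix_fun_def dim quad_form_spectral_sum[OF eigen_system(1)[OF A] v(1)[OF l]] by simp
    also have "(\<Sum>i<n. (cmod (eigvec A i \<bullet>c v l))\<^sup>2) = (\<Sum>i<n. (cmod (v l \<bullet>c eigvec A i))\<^sup>2)"
    proof (intro sum.cong refl)
      fix i assume "i \<in> {..<n}"
      then have "eigvec A i \<in> carrier_vec n" using eigen_system(1)[OF A] by (simp add: orthonormal_def)
      then show "(cmod (eigvec A i \<bullet>c v l))\<^sup>2 = (cmod (v l \<bullet>c eigvec A i))\<^sup>2"
        using cinner_commute[OF v(1)[OF l], of "eigvec A i"] by simp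
    qed
    also have "complex_of_real \<dots> = 1"
      unfolding parseval[OF eigen_system(1)[OF A] v(1)[OF l]] cinner_self[OF v(1)[OF l], symmetric]
      by (rule v(2)[OF l])
    finally show ?thesis by (simp only: of_real_eq_1_iff)
  qed
  define \<Lambda> where "\<Lambda> = (\<lambda>g :: real \<Rightarrow> complex. (\<Sum>i<n. g (?x i)) / of_nat n
    - (\<Sum>l=1..m. \<Sum>t\<in>Z l. complex_of_real (w l t) * g t) / of_nat m)"
  have add: "\<Lambda> (\<lambda>x. g x + h x) = \<Lambda> g + \<Lambda> h" for g h
    by (simp add: \<Lambda>_def sum.distrib distrib_left add_divide_distrib)
  have mult: "\<Lambda> (\<lambda>x. c * g x) = c * \<Lambda> g" for c g
  proof -
    have "(\<Sum>i<n. c * g (?x i)) = c * (\<Sum>i<n. g (?x i))"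
      by (rule sum_distrib_left[symmetric])
    moreover have "(\<Sum>l=1..m. \<Sum>t\<in>Z l. complex_of_real (w l t) * (c * g t))
        = c * (\<Sum>l=1..m. \<Sum>t\<in>Z l. complex_of_real (w l t) * g t)"
      by (simp only: sum_distrib_left mult.left_commute)
    ultimately show ?thesis unfolding \<Lambda>_def by (simp add: right_diff_distrib)
  qed
  have const: "\<Lambda> (\<lambda>x. 1) = 0"
  proof -
    have "(\<Sum>t\<in>Z l. complex_of_real (w l t)) = 1" if "l \<in> {1..m}" for l
      using mass[OF that] by (simp flip: of_real_sum)
    then show ?thesis using n m by (simp add: \<Lambda>_def)
  qed
  have bound: "norm (\<Lambda> g) \<le> 2 * B" if B: "\<And>x. x \<in> {a..b} \<Longrightarrow> norm (g x) \<le> B" for g B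
  proof -
    define X where "X = (\<Sum>i<n. complex_of_real (1 / real n) * g (?x i))"
    define Y where "Y = (\<Sum>l=1..m. complex_of_real (1 / real m) * (\<Sum>t\<in>Z l. complex_of_real (w l t) * g t))"
    have "norm X \<le> B"
      unfolding X_def using n eig B by (intro norm_convex_combination_le) auto
    moreover have "norm Y \<le> B"
      unfolding Y_def
    proof (rule norm_convex_combination_le)
      fix l assume l: "l \<in> {1..m}"
      show "norm (\<Sum>t\<in>Z l. complex_of_real (w l t) * g t) \<le> B"
        by (rule norm_convex_combination_le) (use Z[OF l] w[OF l] mass[OF l] B in auto)
    qed (use m in auto)
    moreover have "\<Lambda> g = X - Y"
      by (simp add: \<Lambda>_def X_def Y_def sum_divide_distrib)
    ultimately show ?thesis using norm_triangle_ineq4[of X Y] by simp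
  qed
  have cheb_small: "norm (\<Lambda> (\<lambda>x. of_real (poly (scaled_cheb a b j) x))) \<le> \<tau>" if j: "1 \<le> j" "j \<le> s" for j
  proof -
    have deg: "degree (scaled_cheb a b j) \<le> s" using degree_scaled_cheb_le[of a b j] j by linarith
    have "mat_trace (cheb_matrix A j) = (\<Sum>i<n. of_real (poly (scaled_cheb a b j) (?x i)))"
      unfolding cheb_matrix_def matrix_fun_def dim mat_trace_spectral_sum[OF eigen_system(1)[OF A]]
      by (simp add: a_def b_def)
    moreover have "quad_form (cheb_matrix A j) (v l)
        = (\<Sum>t\<in>Z l. complex_of_real (w l t) * of_real (poly (scaled_cheb a b j) t))" if "l \<in> {1..m}" for l
      using exact[OF that deg] by (simp add: cheb_matrix_def a_def b_def)
    ultimately have "\<Lambda> (\<lambda>x. of_real (poly (scaled_cheb a b j) x)) = mat_trace (cheb_matrix A j) / of_nat n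
      - (\<Sum>l=1..m. quad_form (cheb_matrix A j) (v l)) / of_nat m"
      by (simp add: \<Lambda>_def)
    then show ?thesis using dev[OF j] by simp
  qed
  have "norm (\<Lambda> (\<lambda>x. f (of_real x))) \<le> 2 * M * \<tau> / (\<rho> - 1) + 4 * M / (\<rho> ^ s * (\<rho> - 1))"
    by (rule Anl_functional_bound[where \<Lambda> = \<Lambda> and a = a and b = b])
      (fact add mult bound const cheb_small ab par f[folded a_def b_def])+
  also have "\<Lambda> (\<lambda>x. f (of_real x)) = mat_trace (matrix_fun f A) / of_nat n
      - (\<Sum>l=1..m. df_integral ?E (gauss_quad (weighted_cesm A (v l)) s) f) / of_nat m"
  proof -
    have "mat_trace (matrix_fun f A) = (\<Sum>i<n. f (of_real (?x i)))"
      unfolding matrix_fun_def dim by (rule mat_trace_spectral_sum[OF eigen_system(1)[OF A]])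
    moreover have "df_integral ?E (gauss_quad (weighted_cesm A (v l)) s) f
        = (\<Sum>t\<in>Z l. complex_of_real (w l t) * f (of_real t))" if l: "l \<in> {1..m}" for l
      unfolding gq[OF l]
    proof (rule df_integral_step_df)
      show "open ?E" by (rule open_bernstein_ellipse[OF par(2) ab])
      show "continuous_on ?E f"
        using f by (auto simp: Anl_def a_def b_def intro!: holomorphic_on_imp_continuous_on analytic_imp_holomorphic)
      show "complex_of_real t \<in> ?E" if "t \<in> Z l" for t
        using that Z(2)[OF l] by (intro interval_subset_bernstein_ellipse par ab) auto
    qed (use Z[OF l] w[OF l] in auto)
    ultimately show ?thesis by (simp add: \<Lambda>_def)
  qed
  finally show ?thesis unfolding a_def b_def .
qed

section \<open>Random samples on the sphere\<close>

lemma sets_unif_sphere: "sets (unif_sphere n) = sets (PiM {..<n} (\<lambda>_. lborel))"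
  by (simp add: unif_sphere_def lborel_n_def)

lemma measurable_euclid_norm: "euclid_norm n \<in> borel_measurable (PiM {..<n} (\<lambda>_. lborel))"
proof -
  have "(\<lambda>x. x i) \<in> borel_measurable (PiM {..<n} (\<lambda>_. lborel :: real measure))" if "i \<in> {..<n}" for i
    using measurable_component_singleton[OF that, of "\<lambda>_. lborel :: real measure"] by simp
  then show ?thesis
    unfolding euclid_norm_def[abs_def]
    by (intro measurable_compose[OF _ borel_measurable_sqrt] borel_measurable_sum borel_measurable_power)
qed

lemma AE_unif_sphere: "AE x in unif_sphere n. euclid_norm n x = 1"
proof -
  let ?L = "PiM {..<n} (\<lambda>_. lborel :: real measure)"
  let ?A = "{x \<in> space ?L. 0 < euclid_norm n x \<and> euclid_norm n x \<le> 1}"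
  let ?dir = "\<lambda>x. \<lambda>i\<in>{..<n}. x i / euclid_norm n x"
  note [measurable] = measurable_euclid_norm
  have comp: "(\<lambda>x. x i) \<in> borel_measurable ?L" if "i \<in> {..<n}" for i
    using measurable_component_singleton[OF that, of "\<lambda>_. lborel :: real measure"] by simp
  have "?dir \<in> ?L \<rightarrow>\<^sub>M ?L"
    by (intro measurable_restrict) (simp add: borel_measurable_divide[OF comp measurable_euclid_norm])
  then have dir: "?dir \<in> uniform_measure ?L ?A \<rightarrow>\<^sub>M ?L"
    by simp
  have "{x \<in> space ?L. euclid_norm n x = 1} \<in> sets ?L" by measurable
  moreover have "AE x in uniform_measure ?L ?A. euclid_norm n (?dir x) = 1"
  proof (rule AE_uniform_measureI)
    show "?A \<in> sets ?L" by measurable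
    have "euclid_norm n (?dir x) = 1" if pos: "0 < euclid_norm n x" for x
    proof -
      have sq: "(euclid_norm n x)\<^sup>2 = (\<Sum>i<n. (x i)\<^sup>2)"
        by (simp add: euclid_norm_def sum_nonneg)
      have "(\<Sum>i<n. (?dir x i)\<^sup>2) = (\<Sum>i<n. (x i)\<^sup>2) / (euclid_norm n x)\<^sup>2"
        by (simp add: power_divide sum_divide_distrib)
      also have "\<dots> = 1" using pos by (simp flip: sq)
      finally show ?thesis unfolding euclid_norm_def[of n "?dir x"] by simp
    qed
    then show "AE x in ?L. x \<in> ?A \<longrightarrow> euclid_norm n (?dir x) = 1" by auto
  qed
  ultimately show ?thesis
    unfolding unif_sphere_def lborel_n_def by (simp add: AE_distr_iff[OF dir])
qed

lemma cvec_carrier [simp]: "cvec n x \<in> carrier_vec n"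
  by (simp add: cvec_def)

lemma cvec_cinner_self: "cvec n x \<bullet>c cvec n x = complex_of_real ((euclid_norm n x)\<^sup>2)"
  unfolding cinner_self[OF cvec_carrier] by (simp add: cvec_def euclid_norm_def sum_nonneg)

lemma quad_form_cvec:
  assumes "B \<in> carrier_mat n n"
  shows "quad_form B (cvec n x) = (\<Sum>a<n. (\<Sum>b<n. B $$ (a, b) * of_real (x b)) * of_real (x a))"
  unfolding quad_form_def cinner_eq_sum[OF cvec_carrier]
proof (intro sum.cong refl)
  fix a assume a: "a \<in> {..<n}"
  have "(B *\<^sub>v cvec n x) $ a = (\<Sum>b<n. B $$ (a, b) * cvec n x $ b)"
    using a by (intro mult_mat_vec_nth[OF assms cvec_carrier]) simp
  also have "\<dots> = (\<Sum>b<n. B $$ (a, b) * of_real (x b))"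
    by (intro sum.cong refl) (simp add: cvec_def)
  finally show "(B *\<^sub>v cvec n x) $ a * cnj (cvec n x $ a) = (\<Sum>b<n. B $$ (a, b) * of_real (x b)) * of_real (x a)"
    using a by (simp add: cvec_def)
qed

lemma measurable_quad_form_cvec:
  assumes B: "B \<in> carrier_mat n n"
  shows "(\<lambda>x. quad_form B (cvec n x)) \<in> borel_measurable (unif_sphere n)"
proof -
  have coord: "(\<lambda>x. x i) \<in> borel_measurable (unif_sphere n)" if "i \<in> {..<n}" for i
    using measurable_component_singleton[OF that, of "\<lambda>_. lborel :: real measure"]
    by (simp add: measurable_cong_sets[OF sets_unif_sphere refl])
  have "(\<lambda>x. complex_of_real (x i)) \<in> borel_measurable (unif_sphere n)" if "i \<in> {..<n}" for i
    by (rule measurable_compose[OF coord[OF that] borel_measurable_of_real])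
  note coord = this
  show ?thesis
    unfolding quad_form_cvec[OF B]
    by (intro borel_measurable_sum borel_measurable_times borel_measurable_const coord)
qed

text \<open>Transfers a tail bound from the product measure to the given samples: independence identifies their
  joint law with the product.\<close>

lemma concentration_for_samples:
  fixes V :: "nat \<Rightarrow> 'w \<Rightarrow> (nat \<Rightarrow> real)" and B :: "complex mat"
  assumes conc: "measure (PiM {1..m} (\<lambda>_. unif_sphere n))
      {v \<in> space (PiM {1..m} (\<lambda>_. unif_sphere n)).
        norm (mat_trace B / of_nat n - (\<Sum>l=1..m. quad_form B (cvec n (v l))) / of_nat m) > t} \<le> p"
    and "0 < m" and B: "B \<in> carrier_mat n n" and P: "prob_space P"
    and indep: "prob_space.indep_vars P (\<lambda>_. unif_sphere n) V {1..m}"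
    and law: "\<And>l. l \<in> {1..m} \<Longrightarrow> distr P (unif_sphere n) (V l) = unif_sphere n"
  defines "bad \<equiv> {\<omega> \<in> space P. norm (mat_trace B / of_nat n
        - (\<Sum>l=1..m. quad_form B (cvec n (V l \<omega>))) / of_nat m) > t}"
  shows "bad \<in> sets P" "emeasure P bad \<le> ennreal p"
proof -
  interpret prob_space P by (rule P)
  let ?U = "unif_sphere n" and ?\<Pi> = "PiM {1..m} (\<lambda>_. unif_sphere n)"
  let ?V = "\<lambda>\<omega>. \<lambda>l\<in>{1..m}. V l \<omega>"
  define E where "E = {v \<in> space ?\<Pi>. norm (mat_trace B / of_nat n
      - (\<Sum>l=1..m. quad_form B (cvec n (v l))) / of_nat m) > t}"
  have rv: "random_variable ?U (V l)" if "l \<in> {1..m}" for l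
    using indep that by (auto simp: indep_vars_def)
  then have meas_V: "?V \<in> P \<rightarrow>\<^sub>M ?\<Pi>" by (intro measurable_restrict)
  have "{1..m} \<noteq> {}" using \<open>0 < m\<close> by simp
  then have "distr P ?\<Pi> ?V = PiM {1..m} (\<lambda>l. distr P ?U (V l))"
    using indep_vars_iff_distr_eq_PiM'[where I = "{1..m}" and M' = "\<lambda>_. ?U" and X = V] rv indep by simp
  also have "\<dots> = ?\<Pi>" by (intro PiM_cong refl law)
  finally have joint: "distr P ?\<Pi> ?V = ?\<Pi>" .
  have quad: "(\<lambda>v. quad_form B (cvec n (v l))) \<in> borel_measurable ?\<Pi>" if "l \<in> {1..m}" for l
    using measurable_compose[OF measurable_component_singleton[OF that] measurable_quad_form_cvec[OF B]] .
  have "(\<lambda>v. mat_trace B / of_nat n - (\<Sum>l=1..m. quad_form B (cvec n (v l))) / of_nat m)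
      \<in> borel_measurable ?\<Pi>"
    by (intro borel_measurable_diff borel_measurable_const borel_measurable_divide borel_measurable_sum quad)
  then have [measurable]: "(\<lambda>v. norm (mat_trace B / of_nat n
      - (\<Sum>l=1..m. quad_form B (cvec n (v l))) / of_nat m)) \<in> borel_measurable ?\<Pi>"
    by (rule measurable_compose[OF _ borel_measurable_norm])
  have E: "E \<in> sets ?\<Pi>" unfolding E_def by measurable
  have bad: "bad = ?V -` E \<inter> space P"
    using measurable_space[OF meas_V] by (auto simp: bad_def E_def)
  show "bad \<in> sets P" unfolding bad using meas_V E by (rule measurable_sets)
  have "emeasure P bad = emeasure (distr P ?\<Pi> ?V) E"
    unfolding bad using meas_V E by (rule emeasure_distr[symmetric])
  also have "\<dots> = ennreal (measure ?\<Pi> E)"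
  proof -
    have "emeasure (distr P ?\<Pi> ?V) E = emeasure P bad"
      unfolding bad using meas_V E by (rule emeasure_distr)
    then have "emeasure ?\<Pi> E \<noteq> \<infinity>" unfolding joint using emeasure_finite by simp
    then show ?thesis unfolding joint by (simp add: emeasure_eq_ennreal_measure)
  qed
  also have "\<dots> \<le> ennreal p" using conc unfolding E_def by (rule ennreal_leI)
  finally show "emeasure P bad \<le> ennreal p" .
qed

lemma samples_on_sphere:
  fixes V :: "nat \<Rightarrow> 'w \<Rightarrow> (nat \<Rightarrow> real)"
  assumes P: "prob_space P" and indep: "prob_space.indep_vars P (\<lambda>_. unif_sphere n) V {1..m}"
    and law: "\<And>l. l \<in> {1..m} \<Longrightarrow> distr P (unif_sphere n) (V l) = unif_sphere n"
  shows "AE \<omega> in P. \<forall>l\<in>{1..m}. euclid_norm n (V l \<omega>) = 1"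
proof (rule AE_finite_allI)
  interpret prob_space P by (rule P)
  fix l assume l: "l \<in> {1..m}"
  have "random_variable (unif_sphere n) (V l)"
    using indep l by (auto simp: indep_vars_def)
  then show "AE \<omega> in P. euclid_norm n (V l \<omega>) = 1"
    by (rule AE_distrD) (simp only: law[OF l] AE_unif_sphere)
qed simp

section \<open>The error probability\<close>

theorem theorem3p15:
  fixes c M \<rho> \<epsilon> \<delta> :: real
    and n s m :: nat
    and A :: "complex mat"
    and P :: "'w measure"
    and V :: "nat \<Rightarrow> 'w \<Rightarrow> (nat \<Rightarrow> real)"
  assumes "c > 0"
    and "\<And>(n::nat) (m::nat) (B::complex mat) (\<epsilon>::real).
           n > 0 \<Longrightarrow> m > 0 \<Longrightarrow> B \<in> carrier_mat n n \<Longrightarrow> \<epsilon> > 0 \<Longrightarrow>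
           measure (PiM {1..m} (\<lambda>_. unif_sphere n))
             {v \<in> space (PiM {1..m} (\<lambda>_. unif_sphere n)).
                norm (mat_trace B / of_nat n
                  - (\<Sum>l=1..m. quad_form B (cvec n (v l))) / of_nat m) > \<epsilon>}
           \<le> 2 * exp (- (c * real n * real m * \<epsilon>\<^sup>2 / (spectral_norm B)\<^sup>2))"
    and "n > 0" and "A \<in> carrier_mat n n" and "hermitian A"
    and "min_eigenvalue A < max_eigenvalue A"
    and "M > 0" and "\<rho> > 1" and "\<epsilon> > 0" and "0 < \<delta>" and "\<delta> < 1"
    and "odd s" and "m > 0"
    and "real s \<ge> ln (8 * M / ((\<rho> - 1) * \<epsilon>)) * (1 / ln \<rho>)"
    and "real m \<ge> 16 * M\<^sup>2 / (c * (\<rho> - 1)\<^sup>2 * real n * \<epsilon>\<^sup>2) * ln (2 * real s / \<delta>)"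
    and "prob_space P"
    and "prob_space.indep_vars P (\<lambda>_. unif_sphere n) V {1..m}"
    and "\<And>l. l \<in> {1..m} \<Longrightarrow> distr P (unif_sphere n) (V l) = unif_sphere n"
  shows "outer_measure_of P
           {\<omega> \<in> space P.
              \<exists>f \<in> Anl M \<rho> (min_eigenvalue A) (max_eigenvalue A).
                norm (mat_trace (matrix_fun f A) / of_nat n
                  - (\<Sum>l=1..m. df_integral (bernstein_ellipse \<rho> (min_eigenvalue A) (max_eigenvalue A))
                        (gauss_quad (weighted_cesm A (cvec n (V l \<omega>))) s) f) / of_nat m) > \<epsilon>}
         \<le> ennreal \<delta>"
proof -
  note c = assms(1) and conc = assms(2) and n = assms(3) and A = assms(5,4) and lt = assms(6)
    and M = assms(7) and \<rho> = assms(8) and \<epsilon> = assms(9) and \<delta> = assms(10,11)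
    and s = assms(12) and m = assms(13) and s_ge = assms(14) and m_ge = assms(15)
    and P = assms(16) and indep = assms(17) and law = assms(18)
  interpret prob_space P by (rule P)
  \<comment> \<open>Chosen such that \<open>2M\<tau>/(\<rho>-1) = \<epsilon>/2\<close>.\<close>
  define \<tau> where "\<tau> = \<epsilon> * (\<rho> - 1) / (4 * M)"
  have "0 < \<tau>" using \<epsilon> \<rho> M by (simp add: \<tau>_def)
  have "0 < s" using s by (auto intro: Nat.gr0I)
  define bad where "bad = (\<lambda>j. {\<omega> \<in> space P. norm (mat_trace (cheb_matrix A j) / of_nat n
        - (\<Sum>l=1..m. quad_form (cheb_matrix A j) (cvec n (V l \<omega>))) / of_nat m) > \<tau>})"
  let ?fail = "{\<omega> \<in> space P.
              \<exists>f \<in> Anl M \<rho> (min_eigenvalue A) (max_eigenvalue A).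
                norm (mat_trace (matrix_fun f A) / of_nat n
                  - (\<Sum>l=1..m. df_integral (bernstein_ellipse \<rho> (min_eigenvalue A) (max_eigenvalue A))
                        (gauss_quad (weighted_cesm A (cvec n (V l \<omega>))) s) f) / of_nat m) > \<epsilon>}"
  have tail: "2 * M * \<tau> / (\<rho> - 1) + 4 * M / (\<rho> ^ s * (\<rho> - 1)) \<le> \<epsilon>"
  proof -
    have "0 < ln \<rho>" using \<rho> by simp
    have "ln (8 * M / ((\<rho> - 1) * \<epsilon>)) \<le> real s * ln \<rho>"
      using s_ge \<open>0 < ln \<rho>\<close> by (simp add: field_simps)
    also have "\<dots> = ln (\<rho> ^ s)" using \<rho> by (simp add: ln_realpow)
    finally have "8 * M / ((\<rho> - 1) * \<epsilon>) \<le> \<rho> ^ s"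
      using M \<rho> \<epsilon> by (subst (asm) ln_le_cancel_iff) auto
    then have "4 * M / (\<rho> ^ s * (\<rho> - 1)) \<le> \<epsilon> / 2"
      using M \<rho> \<epsilon> by (simp add: field_simps)
    moreover have "2 * M * \<tau> / (\<rho> - 1) = \<epsilon> / 2"
    proof -
      have "2 * M * (\<epsilon> * d / (4 * M)) / d = \<epsilon> / 2" if "d \<noteq> 0" for d
        using that M by (simp add: field_simps)
      then show ?thesis using \<rho> by (simp add: \<tau>_def)
    qed
    ultimately show ?thesis by simp
  qed
  have cheb_carrier: "cheb_matrix A j \<in> carrier_mat n n" for j
    using A(2) by (auto simp: cheb_matrix_def matrix_fun_def)
  have prob_bound: "2 * exp (- (c * real n * real m * \<tau>\<^sup>2 / (spectral_norm (cheb_matrix A j))\<^sup>2)) \<le> \<delta> / real s" for j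
  proof -
    \<comment> \<open>The factor in the hypothesis on \<open>m\<close> is the reciprocal of \<open>c n \<tau>\<^sup>2\<close>.\<close>
    have "16 * M\<^sup>2 / (c * (\<rho> - 1)\<^sup>2 * real n * \<epsilon>\<^sup>2) * (c * real n * \<tau>\<^sup>2) = 1"
    proof -
      have "16 * M\<^sup>2 / (c * d\<^sup>2 * x * \<epsilon>\<^sup>2) * (c * x * (\<epsilon> * d / (4 * M))\<^sup>2) = 1" if "d \<noteq> 0" "x \<noteq> 0" for d x
        using that c M \<epsilon> by (simp add: power_divide power_mult_distrib field_simps)
      then show ?thesis using \<rho> n by (simp add: \<tau>_def)
    qed
    then have "ln (2 * real s / \<delta>) = 16 * M\<^sup>2 / (c * (\<rho> - 1)\<^sup>2 * real n * \<epsilon>\<^sup>2) * ln (2 * real s / \<delta>) * (c * real n * \<tau>\<^sup>2)"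
      by (simp only: mult_ac mult_1_right)
    also have "\<dots> \<le> real m * (c * real n * \<tau>\<^sup>2)"
      using m_ge c by (intro mult_right_mono) auto
    finally have "exp (- (c * real n * real m * \<tau>\<^sup>2)) \<le> exp (- ln (2 * real s / \<delta>))"
      by (simp add: mult_ac)
    also have "\<dots> = \<delta> / (2 * real s)" using \<open>0 < s\<close> \<delta> by (simp add: exp_minus)
    finally show ?thesis
      by (simp add: spectral_norm_cheb_matrix[OF A n lt])
  qed
  have bad: "bad j \<in> sets P" "emeasure P (bad j) \<le> ennreal (\<delta> / real s)" for j
  proof -
    note concentration_for_samples[OF conc[OF n m cheb_carrier \<open>0 < \<tau>\<close>] m cheb_carrier P indep law, of j]
    then show "bad j \<in> sets P" "emeasure P (bad j) \<le> ennreal (\<delta> / real s)"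
      using order.trans[OF _ ennreal_leI[OF prob_bound]] by (auto simp: bad_def)
  qed
  obtain N where N: "N \<in> sets P" "emeasure P N = 0"
    and "{\<omega> \<in> space P. \<not> (\<forall>l\<in>{1..m}. euclid_norm n (V l \<omega>) = 1)} \<subseteq> N"
    using samples_on_sphere[OF P indep law] by (auto elim: AE_E)
  then have on_sphere: "euclid_norm n (V l \<omega>) = 1" if "\<omega> \<in> space P - N" "l \<in> {1..m}" for \<omega> l
    using that by blast
  \<comment> \<open>The failure set is an uncountable union over \<open>f\<close> that need not be measurable; it is covered by a
      finite union of measurable sets and a null set.\<close>
  define bads where "bads = (\<Union>j\<in>{1..s}. bad j)"
  have "?fail \<subseteq> bads \<union> N"
  proof (rule subsetI, rule ccontr)
    fix \<omega> assume "\<omega> \<in> ?fail" and good: "\<omega> \<notin> bads \<union> N"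
    then obtain f where \<omega>: "\<omega> \<in> space P" and f: "f \<in> Anl M \<rho> (min_eigenvalue A) (max_eigenvalue A)"
      and large: "norm (mat_trace (matrix_fun f A) / of_nat n
        - (\<Sum>l=1..m. df_integral (bernstein_ellipse \<rho> (min_eigenvalue A) (max_eigenvalue A))
            (gauss_quad (weighted_cesm A (cvec n (V l \<omega>))) s) f) / of_nat m) > \<epsilon>"
      by blast
    have unit: "cvec n (V l \<omega>) \<bullet>c cvec n (V l \<omega>) = 1" if "l \<in> {1..m}" for l
      using on_sphere[OF _ that, of \<omega>] \<omega> good by (simp add: cvec_cinner_self)
    have dev: "norm (mat_trace (cheb_matrix A j) / of_nat n
        - (\<Sum>l=1..m. quad_form (cheb_matrix A j) (cvec n (V l \<omega>))) / of_nat m) \<le> \<tau>" if "1 \<le> j" "j \<le> s" for j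
      using good \<omega> that by (force simp: bads_def bad_def not_less)
    note quadrature_deviation_bound[OF A n lt s m cvec_carrier unit dev M \<rho> less_imp_le[OF \<open>0 < \<tau>\<close>] f]
    with tail large show False by linarith
  qed
  moreover have "bads \<union> N \<in> sets P" using bad(1) N(1) by (auto simp: bads_def)
  ultimately have "outer_measure_of P ?fail \<le> emeasure P (bads \<union> N)"
    unfolding outer_measure_of_def by (intro INF_lower) auto
  also have "\<dots> \<le> emeasure P bads + emeasure P N"
    using bad(1) N(1) by (intro emeasure_subadditive) (auto simp: bads_def)
  also have "\<dots> = emeasure P bads" by (simp add: N)
  also have "\<dots> \<le> (\<Sum>j\<in>{1..s}. emeasure P (bad j))"
    unfolding bads_def using bad(1) by (intro emeasure_subadditive_finite) auto
  also have "\<dots> \<le> (\<Sum>j\<in>{1..s}. ennreal (\<delta> / real s))" by (intro sum_mono bad)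
  also have "\<dots> = ennreal \<delta>"
    using \<open>0 < s\<close> \<delta> by (simp add: ennreal_of_nat_eq_real_of_nat ennreal_mult[symmetric])
  finally show ?thesis .
qed

end
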